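(* Let $n\geq 1$ and $\tau\in S_n$. (i) There is an automorphism of $P_n(\mathbb K)$ whose induced homeomorphism on $S(P_n(\mathbb K))$, under the identification $S(P_n(\mathbb K))\simeq\mathbb S^{n-1}$, is the permutation of coordinates $(x_1,x_2,\dots,x_n)\mapsto(x_{\tau(1)},x_{\tau(2)},\dots,x_{\tau(n)})$. (ii) There is an automorphism of $P_n(\mathbb T)$ whose induced homeomorphism on $S(P_n(\mathbb T))$, under the identification $S(P_n(\mathbb T))\simeq\mathbb S^{2n-1}$, is the permutation of coordinates $(y_1,\dots,y_n)\times(x_1,\dots,x_n)\mapsto(y_{\tau(1)},\dots,y_{\tau(n)})\times(x_{\tau(1)},\dots,x_{\tau(n)})$.
   Context: **Pure braid groups.** $\mathbb T$ is the torus and $\mathbb K$ the Klein bottle. For $M\in\{\mathbb T,\mathbb K\}$, $F_n(M)=\{(x_1,\dots,x_n)\in M^n : x_i\ne x_j\text{ for }i\ne j\}$ and $P_n(M)=\pi_1(F_n(M))$. Write $\pi_1(\mathbb T)=\langle a,b\mid ab=ba\rangle$ and $\pi_1(\mathbb K)=\langle a,b\mid b^{-1}ab=a^{-1}\rangle$. For $1\le i\le n$, $a_i$ (resp. $b_i$) $\in P_n(M)$ is the pure braid in which only the $i$-th string is non-trivial, this string running once along a loop representing $a$ (resp. $b$) and avoiding the other base points. It is known that the abelianization of $P_n(\mathbb T)$ is free abelian with basis the classes of $a_1,b_1,\dots,a_n,b_n$, and the abelianization of $P_n(\mathbb K)$ is $\mathbb Z_2^n\oplus\mathbb Z^n$,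 with torsion part generated by the classes of the $a_i$ and free part having basis the classes of the $b_i$. **Character sphere.** For a finitely generated group $G$, $S(G)=(\mathrm{Hom}(G,\mathbb R)\setminus\{0\})/\sim$ with $\chi\sim\chi'$ iff $\chi'=r\chi$ for some $r>0$. An automorphism $\varphi$ of $G$ induces the homeomorphism $\varphi^*:S(G)\to S(G)$, $[\chi]\mapsto[\chi\circ\varphi]$. The identification $S(P_n(\mathbb K))\simeq\mathbb S^{n-1}$ sends $[\chi]$ to the normalization (to unit length) of $(x_1,\dots,x_n)=(\chi(b_1),\dots,\chi(b_n))$; the identification $S(P_n(\mathbb T))\simeq\mathbb S^{2n-1}$ sends $[\chi]$ to the normalization of $(y_1,\dots,y_n)\times(x_1,\dots,x_n)=(\chi(a_1),\dots,\chi(a_n))\times(\chi(b_1),\dots,\chi(b_n))$. *)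

theory Defs
  imports "HOL-Analysis.Analysis" "HOL-Algebra.Group"
begin

section \<open>The torus and the Klein bottle as quotients of the plane\<close>

text \<open>
  The torus is the quotient of the plane by the translations
  \<open>(x, y) \<mapsto> (x + 1, y)\<close> and \<open>(x, y) \<mapsto> (x, y + 1)\<close>.
\<close>

definition torus_rel :: "real \<times> real \<Rightarrow> real \<times> real \<Rightarrow> bool" where
  "torus_rel z w \<longleftrightarrow>
     (\<exists>k m :: int. w = (fst z + of_int k, snd z + of_int m))"

text \<open>
  The Klein bottle is the quotient of the plane by the group generated by
  \<open>\<alpha> (x, y) = (x + 1, y)\<close> and \<open>\<beta> (x, y) = (- x, y + 1)\<close>, which satisfy
  \<open>\<beta>\<inverse> \<circ> \<alpha> \<circ> \<beta> = \<alpha>\<inverse>\<close>; the elements of this group are the maps \<open>\<alpha>\<^sup>k \<circ> \<beta>\<^sup>m\<close>.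
\<close>

definition klein_rel :: "real \<times> real \<Rightarrow> real \<times> real \<Rightarrow> bool" where
  "klein_rel z w \<longleftrightarrow>
     (\<exists>k m :: int. w = ((if even m then fst z else - fst z) + of_int k, snd z + of_int m))"

lemma equivp_torus_rel: "equivp torus_rel"
proof (rule equivpI)
  show "reflp torus_rel"
    unfolding reflp_def torus_rel_def by (metis add.right_neutral of_int_0 prod.collapse)
  show "symp torus_rel"
  proof (rule sympI)
    fix z w assume "torus_rel z w"
    then obtain k m :: int where "w = (fst z + of_int k, snd z + of_int m)"
      unfolding torus_rel_def by blast
    then show "torus_rel w z"
      unfolding torus_rel_def by (intro exI[of _ "-k"] exI[of _ "-m"]) auto
  qed
  show "transp torus_rel"
  proof (rule transpI)
    fix z w v assume "torus_rel z w" "torus_rel w v"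
    then obtain k m k' m' :: int where "w = (fst z + of_int k, snd z + of_int m)"
        "v = (fst w + of_int k', snd w + of_int m')"
      unfolding torus_rel_def by blast
    then show "torus_rel z v"
      unfolding torus_rel_def by (intro exI[of _ "k + k'"] exI[of _ "m + m'"]) auto
  qed
qed

lemma equivp_klein_rel: "equivp klein_rel"
proof (rule equivpI)
  show "reflp klein_rel"
    unfolding reflp_def klein_rel_def
    by (intro allI exI[of _ "0::int"]) simp
  show "symp klein_rel"
  proof (rule sympI)
    fix z w assume "klein_rel z w"
    then obtain k m :: int where
      "w = ((if even m then fst z else - fst z) + of_int k, snd z + of_int m)"
      unfolding klein_rel_def by blast
    then show "klein_rel w z"
      unfolding klein_rel_def
      by (intro exI[of _ "if even m then - k else k"] exI[of _ "-m"]) auto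
  qed
  show "transp klein_rel"
  proof (rule transpI)
    fix z w v assume "klein_rel z w" "klein_rel w v"
    then obtain k m k' m' :: int where
        "w = ((if even m then fst z else - fst z) + of_int k, snd z + of_int m)"
        "v = ((if even m' then fst w else - fst w) + of_int k', snd w + of_int m')"
      unfolding klein_rel_def by blast
    then show "klein_rel z v"
      unfolding klein_rel_def
      by (intro exI[of _ "(if even m' then k else - k) + k'"] exI[of _ "m + m'"]) auto
  qed
qed

quotient_type torus = "real \<times> real" / torus_rel
  by (rule equivp_torus_rel)

quotient_type klein = "real \<times> real" / klein_rel
  by (rule equivp_klein_rel)

text \<open>Both surfaces carry the quotient topology.\<close>

instantiation torus :: topological_space
begin

definition open_torus :: "torus set \<Rightarrow> bool" where
  "open_torus U \<longleftrightarrow> open (abs_torus -` U)"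

instance
  by standard (auto simp: open_torus_def vimage_Union)

end

instantiation klein :: topological_space
begin

definition open_klein :: "klein set \<Rightarrow> bool" where
  "open_klein U \<longleftrightarrow> open (abs_klein -` U)"

instance
  by standard (auto simp: open_klein_def vimage_Union)

end

text \<open>
  Loops at the image of the origin representing the generators \<open>a\<close> and \<open>b\<close>. They lift to paths
  from the origin to its image under the two deck transformations above, so that
  \<open>ab = ba\<close> holds in the torus and \<open>b\<inverse>ab = a\<inverse>\<close> holds in the Klein bottle.
\<close>

definition torus_loop_a :: "real \<Rightarrow> torus" where
  "torus_loop_a t = abs_torus (t, 0)"

definition torus_loop_b :: "real \<Rightarrow> torus" where
  "torus_loop_b t = abs_torus (0, t)"

definition klein_loop_a :: "real \<Rightarrow> klein" where
  "klein_loop_a t = abs_klein (t, 0)"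

definition klein_loop_b :: "real \<Rightarrow> klein" where
  "klein_loop_b t = abs_klein (0, t)"


section \<open>Fundamental groups and pure braid groups\<close>

definition based_loops :: "'a::topological_space set \<Rightarrow> 'a \<Rightarrow> (real \<Rightarrow> 'a) set" where
  "based_loops S p =
     {g. path g \<and> path_image g \<subseteq> S \<and> pathstart g = p \<and> pathfinish g = p}"

definition path_class :: "'a::topological_space set \<Rightarrow> (real \<Rightarrow> 'a) \<Rightarrow> (real \<Rightarrow> 'a) set" where
  "path_class S g = {h. homotopic_paths S g h}"

definition fundamental_group ::
  "'a::topological_space set \<Rightarrow> 'a \<Rightarrow> (real \<Rightarrow> 'a) set monoid" where
  "fundamental_group S p =
     \<lparr> carrier = path_class S ` based_loops S p,
       mult = (\<lambda>A B. \<Union>g\<in>A. \<Union>h\<in>B. path_class S (g +++ h)),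
       one = path_class S (\<lambda>_. p) \<rparr>"

lemma path_class_eqI: "homotopic_paths S g h \<Longrightarrow> path_class S g = path_class S h"
  unfolding path_class_def
  by (auto intro: homotopic_paths_trans homotopic_paths_sym)

lemma fundamental_group_mult:
  assumes "g \<in> based_loops S p" "h \<in> based_loops S p"
  shows "path_class S g \<otimes>\<^bsub>fundamental_group S p\<^esub> path_class S h = path_class S (g +++ h)"
proof -
  have "path_class S (g' +++ h') = path_class S (g +++ h)"
    if "g' \<in> path_class S g" "h' \<in> path_class S h" for g' h'
    using that assms
    by (intro path_class_eqI homotopic_paths_sym[OF homotopic_paths_join])
       (auto simp: path_class_def based_loops_def)
  moreover have "g \<in> path_class S g" "h \<in> path_class S h"
    using assms by (auto simp: path_class_def based_loops_def)
  ultimately have "(\<Union>g'\<in>path_class S g. \<Union>h'\<in>path_class S h. path_class S (g' +++ h')) =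
      path_class S (g +++ h)"
    by blast
  then show ?thesis
    by (simp add: fundamental_group_def)
qed

lemma group_fundamental_group:
  assumes "p \<in> S"
  shows "group (fundamental_group S p)"
proof (rule groupI)
  let ?G = "fundamental_group S p"
  have car: "carrier ?G = path_class S ` based_loops S p"
    and one: "\<one>\<^bsub>?G\<^esub> = path_class S (\<lambda>_. p)"
    by (auto simp: fundamental_group_def)
  have join: "g +++ h \<in> based_loops S p" if "g \<in> based_loops S p" "h \<in> based_loops S p" for g h
    using that by (auto simp: based_loops_def path_image_join)
  have rev: "reversepath g \<in> based_loops S p" if "g \<in> based_loops S p" for g
    using that by (auto simp: based_loops_def)
  have cl: "(\<lambda>_. p) \<in> based_loops S p"
    using assms by (auto simp: based_loops_def path_def path_image_def pathstart_def pathfinish_def)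
  show "\<one>\<^bsub>?G\<^esub> \<in> carrier ?G" using cl by (auto simp: car one)
  fix x assume "x \<in> carrier ?G"
  then obtain g where g: "g \<in> based_loops S p" "x = path_class S g" by (auto simp: car)
  have contg: "continuous_on {0..1} g" "g \<in> {0..1} \<rightarrow> S" and g01: "g 0 = p" "g 1 = p"
    using g(1) by (auto simp: based_loops_def path_def path_image_def pathstart_def pathfinish_def)
  let ?e = "linepath 0 1 :: real \<Rightarrow> real"
  have e: "path ?e" "path_image ?e \<subseteq> {0..1}"
    by (auto simp: closed_segment_eq_real_ivl)
  have ge: "g \<circ> ?e = g"
    by (auto simp: linepath_def)
  have "homotopic_paths S (g \<circ> (linepath 0 0 +++ ?e)) (g \<circ> ?e)"
    using homotopic_paths_lid[OF e] contg by (intro homotopic_paths_continuous_image) auto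
  moreover have "g \<circ> (linepath 0 0 +++ ?e) = (\<lambda>_. p) +++ g"
    by (auto simp: joinpaths_def linepath_def g01)
  ultimately show "\<one>\<^bsub>?G\<^esub> \<otimes>\<^bsub>?G\<^esub> x = x"
    using path_class_eqI by (simp add: one g fundamental_group_mult cl ge)
  have "homotopic_paths S (g \<circ> (reversepath ?e +++ ?e)) (g \<circ> linepath 1 1)"
    using homotopic_paths_linv[OF e] contg by (intro homotopic_paths_continuous_image) auto
  moreover have "g \<circ> (reversepath ?e +++ ?e) = reversepath g +++ g"
    by (auto simp: joinpaths_def linepath_def reversepath_def)
  moreover have "g \<circ> linepath 1 1 = (\<lambda>_. p)"
    by (auto simp: linepath_def g01)
  ultimately have "path_class S (reversepath g) \<otimes>\<^bsub>?G\<^esub> x = \<one>\<^bsub>?G\<^esub>"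
    using path_class_eqI g rev by (simp add: one fundamental_group_mult)
  then show "\<exists>y\<in>carrier ?G. y \<otimes>\<^bsub>?G\<^esub> x = \<one>\<^bsub>?G\<^esub>"
    using rev g by (auto simp: car)
  fix y assume "y \<in> carrier ?G"
  then obtain h where h: "h \<in> based_loops S p" "y = path_class S h" by (auto simp: car)
  show "x \<otimes>\<^bsub>?G\<^esub> y \<in> carrier ?G"
    using g h join by (auto simp: fundamental_group_mult car)
  fix z assume "z \<in> carrier ?G"
  then obtain k where k: "k \<in> based_loops S p" "z = path_class S k" by (auto simp: car)
  show "x \<otimes>\<^bsub>?G\<^esub> y \<otimes>\<^bsub>?G\<^esub> z = x \<otimes>\<^bsub>?G\<^esub> (y \<otimes>\<^bsub>?G\<^esub> z)"
  proof -
    have "homotopic_paths S (g +++ (h +++ k)) ((g +++ h) +++ k)"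
      using g(1) h(1) k(1) by (intro homotopic_paths_assoc) (auto simp: based_loops_def)
    from path_class_eqI[OF this] show ?thesis
      using g h k by (simp add: fundamental_group_mult join)
  qed
qed

text \<open>
  The strings are indexed by the finite type \<open>'n\<close> (so \<open>n = CARD('n) \<ge> 1\<close>), and the space \<open>M\<close> is
  the whole type \<open>'m\<close>.
\<close>

definition config_space :: "('m::topological_space ^ 'n) set" where
  "config_space = {x. \<forall>i j. i \<noteq> j \<longrightarrow> x $ i \<noteq> x $ j}"

definition pure_braid_group ::
  "'m::topological_space ^ 'n \<Rightarrow> (real \<Rightarrow> 'm ^ 'n) set monoid" where
  "pure_braid_group p = fundamental_group config_space p"

text \<open>
  The pure braids with base configuration \<open>p\<close> in which only the \<open>i\<close>-th string moves, and this
  string runs once along a loop representing the same element as \<open>l\<close>. As the loop is based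
  at \<open>p $ i\<close> and not at the base point of \<open>l\<close>, ``representing'' means being freely homotopic in
  \<open>M\<close>. The other base points are avoided because the braid lies in the configuration space.
\<close>

definition single_string_braids ::
  "'m::topological_space ^ 'n \<Rightarrow> (real \<Rightarrow> 'm) \<Rightarrow> 'n \<Rightarrow> (real \<Rightarrow> 'm ^ 'n) set set" where
  "single_string_braids p l i =
     {path_class config_space g | g.
        g \<in> based_loops config_space p \<and>
        (\<forall>j. j \<noteq> i \<longrightarrow> (\<forall>t\<in>{0..1}. g t $ j = p $ j)) \<and>
        homotopic_loops UNIV (\<lambda>t. g t $ i) l}"


section \<open>The character sphere\<close>

definition additive_reals :: "real monoid" where
  "additive_reals = \<lparr> carrier = UNIV, mult = (+), one = 0 \<rparr>"

definition nonzero_characters :: "('g, 'x) monoid_scheme \<Rightarrow> ('g \<Rightarrow> real) set" where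
  "nonzero_characters G =
     {u \<in> hom G additive_reals \<inter> extensional (carrier G). \<exists>x\<in>carrier G. u x \<noteq> 0}"

definition character_rel ::
  "('g, 'x) monoid_scheme \<Rightarrow> (('g \<Rightarrow> real) \<times> ('g \<Rightarrow> real)) set" where
  "character_rel G =
     {(u, v). u \<in> nonzero_characters G \<and> v \<in> nonzero_characters G \<and>
        (\<exists>r>0. \<forall>x\<in>carrier G. v x = r * u x)}"

definition character_sphere :: "('g, 'x) monoid_scheme \<Rightarrow> ('g \<Rightarrow> real) set set" where
  "character_sphere G = nonzero_characters G // character_rel G"

definition induced_sphere_map ::
  "('g, 'x) monoid_scheme \<Rightarrow> ('g \<Rightarrow> 'g) \<Rightarrow> ('g \<Rightarrow> real) set \<Rightarrow> ('g \<Rightarrow> real) set" where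
  "induced_sphere_map G \<phi> C = (\<Union>u\<in>C. character_rel G `` {compose (carrier G) u \<phi>})"

text \<open>
  The identifications of the character spheres with Euclidean unit spheres. Here \<open>sgn v\<close> is
  the unit vector \<open>v / norm v\<close>, which depends only on the class of the character, so the sets below
  are singletons. The Euclidean space of dimension \<open>2 n\<close> is the product of two copies of the one
  of dimension \<open>n\<close>.
\<close>

definition klein_sphere_coords ::
  "('n \<Rightarrow> 'g) \<Rightarrow> ('g \<Rightarrow> real) set \<Rightarrow> real ^ 'n" where
  "klein_sphere_coords b C = the_elem ((\<lambda>u. sgn (\<chi> i. u (b i))) ` C)"

definition torus_sphere_coords ::
  "('n \<Rightarrow> 'g) \<Rightarrow> ('n \<Rightarrow> 'g) \<Rightarrow> ('g \<Rightarrow> real) set \<Rightarrow> (real ^ 'n) \<times> (real ^ 'n)" where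
  "torus_sphere_coords a b C =
     the_elem ((\<lambda>u. sgn (\<chi> i. u (a i), \<chi> i. u (b i))) ` C)"

definition permute_coords :: "('n \<Rightarrow> 'n) \<Rightarrow> real ^ 'n \<Rightarrow> real ^ 'n" where
  "permute_coords \<tau> x = (\<chi> i. x $ \<tau> i)"

end

theory Submission
  imports Defs
begin

text \<open>
  A character \<open>u\<close> of the braid group extends to an additive, homotopy invariant function \<open>w\<close> on paths
  of the configuration space. Pulled back to the cover of the configuration space inside the
  \<open>n\<close>-th power of the plane, which is the complement of a locally finite arrangement of
  subspaces \<open>z\<^sub>j = \<gamma> z\<^sub>i\<close> of codimension two, \<open>w\<close> vanishes on the meridian of each of them: moving the
  \<open>i\<close>-th string once around a horizontal circle and the \<open>j\<close>-th string once around a curve that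
  meets this circle in a single point exhibits the meridian as a commutator. Hence \<open>w\<close> is the
  difference of a potential at the two ends of a path, and this makes \<open>u\<close>, on a braid in which
  only the \<open>j\<close>-th string moves, depend only on \<open>j\<close> and the free homotopy class of that string in
  the surface. A permutation of the coordinates of the configuration space, followed by a change
  of base point, is therefore an automorphism with the required effect.
\<close>

section \<open>Path cocycles and their potentials\<close>

text \<open>The abelianization is never computed: it is enough that the permuted braid and
  \<open>b (\<tau> i)\<close> have the same value under every character. Both move only the string
  \<open>\<tau> i\<close>, but they need not be conjugate: their base configurations differ, and
  their loops, though freely homotopic in the surface, may pass the other strings in different ways.
  This discrepancy is made of meridians, so the geometry goes into killing meridians. Values on
  paths are needed because the lift of a braid is in general not closed: its ends differ by a deck
  transformation of one coordinate, and the value of the braid is the jump of the potential under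
  it. The deck group of the Klein bottle is not abelian, so a careless choice of lifts would replace
  this transformation by a conjugate; lifting free homotopies from one fixed lift of
  \<open>l\<close> keeps it the same for all braids compared.\<close>

definition path_cocycle :: "'a::topological_space set \<Rightarrow> ((real \<Rightarrow> 'a) \<Rightarrow> real) \<Rightarrow> bool" where
  "path_cocycle S w \<longleftrightarrow>
     (\<forall>g h. homotopic_paths S g h \<longrightarrow> w g = w h) \<and>
     (\<forall>g h. path g \<and> path h \<and> path_image g \<subseteq> S \<and> path_image h \<subseteq> S \<and> pathfinish g = pathstart h \<longrightarrow>
        w (g +++ h) = w g + w h)"

definition potential :: "'a::topological_space set \<Rightarrow> ((real \<Rightarrow> 'a) \<Rightarrow> real) \<Rightarrow> ('a \<Rightarrow> real) \<Rightarrow> bool" where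
  "potential U w f \<longleftrightarrow>
     (\<forall>g. path g \<and> path_image g \<subseteq> U \<longrightarrow> w g = f (pathfinish g) - f (pathstart g))"

lemma path_cocycle_homotopic: "path_cocycle S w \<Longrightarrow> homotopic_paths S g h \<Longrightarrow> w g = w h"
  unfolding path_cocycle_def by blast

lemma path_cocycle_join:
  assumes "path_cocycle S w" "path g" "path h" "path_image g \<subseteq> S" "path_image h \<subseteq> S"
    "pathfinish g = pathstart h"
  shows "w (g +++ h) = w g + w h"
  using assms unfolding path_cocycle_def by blast

lemma potentialD:
  "potential U w f \<Longrightarrow> path g \<Longrightarrow> path_image g \<subseteq> U \<Longrightarrow> w g = f (pathfinish g) - f (pathstart g)"
  unfolding potential_def by blast

text \<open>The configuration space carries no linear structure, so constant paths are written
  \<open>\<lambda>_. a\<close>, and the homotopy is made in the unit interval, where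
  \<open>g\<close> corresponds to the identity path, and then pushed forward along
  \<open>g\<close>.\<close>

lemma homotopic_paths_rinv_const:
  fixes g :: "real \<Rightarrow> 'a::topological_space"
  assumes "path g" "path_image g \<subseteq> S"
  shows "homotopic_paths S (g +++ reversepath g) (\<lambda>_. pathstart g)"
proof -
  let ?e = "linepath 0 1 :: real \<Rightarrow> real"
  have e: "path ?e" "path_image ?e \<subseteq> {0..1}"
    by (auto simp: closed_segment_eq_real_ivl)
  have c: "continuous_on {0..1} g" "g \<in> {0..1} \<rightarrow> S"
    using assms by (auto simp: path_def path_image_def)
  have "homotopic_paths S (g \<circ> (?e +++ reversepath ?e)) (g \<circ> linepath 0 0)"
    using homotopic_paths_rinv[OF e] c by (intro homotopic_paths_continuous_image) auto
  moreover have "g \<circ> (?e +++ reversepath ?e) = g +++ reversepath g"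
    by (auto simp: joinpaths_def linepath_def reversepath_def)
  moreover have "g \<circ> linepath 0 0 = (\<lambda>_. pathstart g)"
    by (auto simp: linepath_def pathstart_def)
  ultimately show ?thesis by simp
qed

lemma path_const [simp]: "path (\<lambda>_. a)"
  by (simp add: path_def)

lemma path_cocycle_const:
  assumes "path_cocycle S w" "a \<in> S"
  shows "w (\<lambda>_. a) = 0"
proof -
  have "(\<lambda>_. a) +++ (\<lambda>_. a) = (\<lambda>_. a)"
    by (auto simp: joinpaths_def)
  with path_cocycle_join[OF assms(1), of "\<lambda>_. a" "\<lambda>_. a"] assms(2) show ?thesis
    by (simp add: path_image_def pathstart_def pathfinish_def)
qed

lemma path_cocycle_linepath_refl:
  fixes a :: "'a::real_normed_vector"
  assumes "path_cocycle S w" "a \<in> S"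
  shows "w (linepath a a) = 0"
proof -
  have "linepath a a = (\<lambda>_. a)" by (simp add: fun_eq_iff)
  then show ?thesis using path_cocycle_const[OF assms] by simp
qed

lemma path_cocycle_reversepath:
  assumes w: "path_cocycle S w" and g: "path g" "path_image g \<subseteq> S"
  shows "w (reversepath g) = - w g"
proof -
  have "w (g +++ reversepath g) = 0"
    using path_cocycle_homotopic[OF w homotopic_paths_rinv_const[OF g]] path_cocycle_const[OF w] g
    by (metis pathstart_in_path_image subsetD)
  moreover have "w (g +++ reversepath g) = w g + w (reversepath g)"
    using g by (intro path_cocycle_join[OF w]) auto
  ultimately show ?thesis by simp
qed

text \<open>The potential is the value of a chosen path from a base point \<open>x0\<close>; closing
  \<open>g\<close> up with two chosen paths turns vanishing on loops into path independence.\<close>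

lemma ex_potential:
  assumes w: "path_cocycle S w" and U: "U \<subseteq> S" "path_connected U"
    and loops: "\<And>g. path g \<Longrightarrow> path_image g \<subseteq> U \<Longrightarrow> pathfinish g = pathstart g \<Longrightarrow> w g = 0"
  shows "\<exists>f. potential U w f"
proof (cases "U = {}")
  case True
  then show ?thesis by (simp add: potential_def)
next
  case False
  then obtain x0 where x0: "x0 \<in> U" by blast
  have "\<forall>x\<in>U. \<exists>g. path g \<and> path_image g \<subseteq> U \<and> pathstart g = x0 \<and> pathfinish g = x"
    using U(2) x0 unfolding path_connected_def by blast
  then obtain c where c: "\<And>x. x \<in> U \<Longrightarrow>
      path (c x) \<and> path_image (c x) \<subseteq> U \<and> pathstart (c x) = x0 \<and> pathfinish (c x) = x"
    by metis
  have "w g = w (c (pathfinish g)) - w (c (pathstart g))" if g: "path g" "path_image g \<subseteq> U" for g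
  proof -
    let ?a = "c (pathstart g)" and ?b = "c (pathfinish g)"
    have ab: "pathstart g \<in> U" "pathfinish g \<in> U"
      using g by auto
    note ca = c[OF ab(1)] and cb = c[OF ab(2)]
    have sub: "path_image ?a \<subseteq> S" "path_image ?b \<subseteq> S" "path_image g \<subseteq> S"
      using ca cb g U by auto
    have "0 = w (?a +++ (g +++ reversepath ?b))"
      using ca cb g by (intro loops[symmetric]) (auto simp: path_image_join)
    also have "\<dots> = w ?a + w (g +++ reversepath ?b)"
      using ca cb g sub by (intro path_cocycle_join[OF w]) (auto simp: path_image_join)
    also have "w (g +++ reversepath ?b) = w g + w (reversepath ?b)"
      using ca cb g sub by (intro path_cocycle_join[OF w]) (auto simp: path_image_join)
    also have "w (reversepath ?b) = - w ?b"
      using cb sub by (intro path_cocycle_reversepath[OF w]) auto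
    finally show ?thesis by simp
  qed
  then have "potential U w (\<lambda>x. w (c x))" unfolding potential_def by simp
  then show ?thesis by blast
qed

lemma ex_potential_convex:
  fixes U :: "'a::real_normed_vector set"
  assumes w: "path_cocycle S w" and U: "U \<subseteq> S" "convex U"
  shows "\<exists>f. potential U w f"
proof (rule ex_potential[OF w U(1) convex_imp_path_connected[OF U(2)]])
  fix g assume g: "path g" "path_image g \<subseteq> U" "pathfinish g = pathstart g"
  let ?a = "pathstart g"
  have a: "?a \<in> U" using g by auto
  have "homotopic_paths S g (linepath ?a ?a)"
  proof (rule homotopic_paths_linear)
    fix t :: real assume t: "t \<in> {0..1}"
    then have "g t \<in> U" using g by (auto simp: path_image_def)
    with a U show "closed_segment (g t) (linepath ?a ?a t) \<subseteq> S"
      by (metis closed_segment_subset linepath_refl subset_trans)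
  qed (use g in auto)
  then show "w g = 0"
    using path_cocycle_homotopic[OF w] path_cocycle_linepath_refl[OF w] a U by fastforce
qed

lemma potential_diff:
  assumes "potential U w f" "potential V w f'" "path_connected A" "A \<subseteq> U" "A \<subseteq> V" "x \<in> A" "y \<in> A"
  shows "f x - f' x = f y - f' y"
proof -
  obtain g where g: "path g" "path_image g \<subseteq> A" "pathstart g = x" "pathfinish g = y"
    using assms unfolding path_connected_def by blast
  have "w g = f y - f x" "w g = f' y - f' x"
    using potentialD[OF assms(1) g(1)] potentialD[OF assms(2) g(1)] g assms by auto
  then show ?thesis by simp
qed

text \<open>A Lebesgue number cuts \<open>g\<close> into pieces each staying in one
  \<open>W\<close>, and the increments of \<open>f\<close> telescope. One \<open>f\<close> must
  serve every \<open>W\<close>, so local potentials have to be matched beforehand.\<close>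

lemma potential_glue:
  fixes f :: "'a::real_normed_vector \<Rightarrow> real"
  assumes w: "path_cocycle S w" and US: "U \<subseteq> S"
    and W: "\<And>W. W \<in> \<W> \<Longrightarrow> open W" "U \<subseteq> \<Union>\<W>"
    and pot: "\<And>W. W \<in> \<W> \<Longrightarrow> potential (U \<inter> W) w f"
  shows "potential U w f"
  unfolding potential_def
proof (intro allI impI)
  fix g assume "path g \<and> path_image g \<subseteq> U"
  then have g: "path g" "path_image g \<subseteq> U" by auto
  then have cg: "continuous_on {0..1} g" by (simp add: path_def)
  have "\<exists>V. open V \<and> V \<inter> {0..1} = g -` W \<inter> {0..1}" if "W \<in> \<W>" for W
    using W(1)[OF that] cg by (simp add: continuous_on_open_invariant)
  then obtain V where V: "\<And>W. W \<in> \<W> \<Longrightarrow> open (V W) \<and> V W \<inter> {0..1} = g -` W \<inter> {0..1}"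
    by metis
  have gU: "g t \<in> U" if "t \<in> {0..1}" for t
    using g that by (auto simp: path_image_def)
  have cov: "{0..1} \<subseteq> \<Union>(V ` \<W>)"
  proof
    fix t :: real assume t: "t \<in> {0..1}"
    with gU W(2) obtain W where "W \<in> \<W>" "g t \<in> W" by blast
    with V t have "t \<in> V W" by blast
    with \<open>W \<in> \<W>\<close> show "t \<in> \<Union>(V ` \<W>)" by blast
  qed
  then have ne: "V ` \<W> \<noteq> {}" by force
  have opn: "open B" if "B \<in> V ` \<W>" for B using V that by blast
  obtain d where d: "0 < d" "\<And>T. T \<subseteq> {0..1} \<Longrightarrow> diameter T < d \<Longrightarrow> \<exists>B\<in>V ` \<W>. T \<subseteq> B"
    using Lebesgue_number_lemma[OF compact_Icc ne cov opn] by metis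
  obtain N :: nat where N: "1 / real (Suc N) < d"
    by (rule nat_approx_posE[OF d(1)])
  define n where "n = Suc N"
  have n: "n > 0" "1 / real n < d" using N by (auto simp: n_def)
  have step: "w (subpath (real k / n) (real (Suc k) / n) g) = f (g (real (Suc k) / n)) - f (g (real k / n))"
    if "k < n" for k
  proof -
    have le: "real k / n \<le> real (Suc k) / n" "0 \<le> real k / n" "real (Suc k) / n \<le> 1"
      using that by (auto simp: divide_simps)
    have "diameter {real k / n..real (Suc k) / n} = 1 / n"
      using le n by (simp add: diameter_closed_interval diff_divide_distrib[symmetric])
    with d(2)[of "{real k / n..real (Suc k) / n}"] le n obtain W where WW: "W \<in> \<W>" "{real k / n..real (Suc k) / n} \<subseteq> V W"
      by auto
    have sub: "g ` {real k / n..real (Suc k) / n} \<subseteq> U \<inter> W"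
    proof clarify
      fix t assume t: "t \<in> {real k / n..real (Suc k) / n}"
      then have t01: "t \<in> {0..1}" using le unfolding atLeastAtMost_iff by linarith
      then show "g t \<in> U \<inter> W" using gU WW V t by blast
    qed
    have "path (subpath (real k / n) (real (Suc k) / n) g)"
      using g le by (intro path_subpath) auto
    moreover have "path_image (subpath (real k / n) (real (Suc k) / n) g) \<subseteq> U \<inter> W"
      using sub le by (simp add: path_image_subpath)
    ultimately show ?thesis
      using potentialD[OF pot[OF WW(1)]] by simp
  qed
  have "w (subpath 0 (real k / n) g) = f (g (real k / n)) - f (g 0)" if "k \<le> n" for k
    using that
  proof (induction k)
    case 0
    have "subpath 0 0 g = (\<lambda>_. g 0)" by (simp add: subpath_def)
    with path_cocycle_const[OF w, of "g 0"] gU[of 0] US show ?case by auto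
  next
    case (Suc k)
    have le: "real k / n \<le> real (Suc k) / n" "0 \<le> real k / n" "real (Suc k) / n \<le> 1" "real k / n \<le> 1"
      using Suc.prems by (auto simp: divide_simps)
    have gS: "path_image g \<subseteq> S" using g US by auto
    have "homotopic_paths S (subpath 0 (real k/n) g +++ subpath (real k/n) (real (Suc k) / n) g) (subpath 0 (real (Suc k) / n) g)"
      using g gS le by (intro homotopic_join_subpaths1) auto
    then have "w (subpath 0 (real (Suc k) / n) g) = w (subpath 0 (real k/n) g +++ subpath (real k/n) (real (Suc k) / n) g)"
      using path_cocycle_homotopic[OF w] by metis
    also have "\<dots> = w (subpath 0 (real k/n) g) + w (subpath (real k/n) (real (Suc k) / n) g)"
      using g gS le path_image_subpath_subset[of 0 "real k/n" g] path_image_subpath_subset[of "real k/n" "real (Suc k)/n" g]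
      by (intro path_cocycle_join[OF w] path_subpath) auto
    also have "\<dots> = f (g (real (Suc k) / n)) - f (g 0)"
      using Suc step[of k] by auto
    finally show ?case .
  qed
  from this[of n] n show "w g = f (pathfinish g) - f (pathstart g)"
    by (simp add: pathfinish_def pathstart_def)
qed

section \<open>Complements of arrangements of codimension two\<close>

text \<open>
  The small square around the origin differs from the big one by three rectangles on which \<open>v\<close> has
  potentials, and the big one cancels because its opposite sides have equal values.
\<close>

lemma small_square_zero:
  fixes v :: "(real \<Rightarrow> real \<times> real) \<Rightarrow> real"
  assumes v: "path_cocycle ({a..c} \<times> {a..c} - {0}) v"
    and abc: "a < 0" "0 < b" "b < c"
    and hor: "v (linepath (a, a) (c, a)) = v (linepath (a, c) (c, c))"
    and ver: "v (linepath (a, a) (a, c)) = v (linepath (c, a) (c, c))"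
  shows "v (linepath (a, a) (b, a)) + v (linepath (b, a) (b, b)) +
         v (linepath (b, b) (a, b)) + v (linepath (a, b) (a, a)) = 0"
proof -
  let ?Q = "{a..c} \<times> {a..c}"
  let ?R = "?Q \<inter> {0<..} \<times> UNIV" and ?T = "?Q \<inter> UNIV \<times> {0<..}"
    and ?L = "?Q \<inter> {..<0} \<times> UNIV" and ?B = "?Q \<inter> UNIV \<times> {..<0}"
  have cv: "convex ?R" "convex ?T" "convex ?L" "convex ?B"
    by (auto intro!: convex_Int convex_Times)
  have "?R \<subseteq> ?Q - {0}" "?T \<subseteq> ?Q - {0}" "?L \<subseteq> ?Q - {0}" "?B \<subseteq> ?Q - {0}"
    by (auto simp: zero_prod_def)
  from ex_potential_convex[OF v this(1) cv(1)] ex_potential_convex[OF v this(2) cv(2)]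
    ex_potential_convex[OF v this(3) cv(3)] ex_potential_convex[OF v this(4) cv(4)]
  obtain fR fT fL fB where
    f: "potential ?R v fR" "potential ?T v fT" "potential ?L v fL" "potential ?B v fB"
    by metis
  have e: "v (linepath x y) = f y - f x" if "potential U v f" "convex U" "x \<in> U" "y \<in> U" for U f x y
    using potentialD[OF that(1), of "linepath x y"] that closed_segment_subset[of x U y] by simp
  note eR = e[OF f(1) cv(1)] and eT = e[OF f(2) cv(2)] and eL = e[OF f(3) cv(3)] and eB = e[OF f(4) cv(4)]
  \<comment> \<open>In a quadrant, two potentials measure the same segment from the corner of the
    small square to that of the big one. In the quadrant of \<open>(a, a)\<close> the two corners
    coincide, which leaves three such relations.\<close>
  have "fR (c, c) - fR (b, b) = fT (c, c) - fT (b, b)"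
    using eR[of "(b, b)" "(c, c)"] eT[of "(b, b)" "(c, c)"] abc by simp
  moreover have "fR (c, a) - fR (b, a) = fB (c, a) - fB (b, a)"
    using eR[of "(b, a)" "(c, a)"] eB[of "(b, a)" "(c, a)"] abc by simp
  moreover have "fL (a, c) - fL (a, b) = fT (a, c) - fT (a, b)"
    using eL[of "(a, b)" "(a, c)"] eT[of "(a, b)" "(a, c)"] abc by simp
  moreover have "fB (c, a) - fB (a, a) = fT (c, c) - fT (a, c)"
    using hor eB[of "(a, a)" "(c, a)"] eT[of "(a, c)" "(c, c)"] abc by simp
  moreover have "fL (a, c) - fL (a, a) = fR (c, c) - fR (c, a)"
    using ver eL[of "(a, a)" "(a, c)"] eR[of "(c, a)" "(c, c)"] abc by simp
  moreover have "v (linepath (a, a) (b, a)) = fB (b, a) - fB (a, a)"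
    "v (linepath (b, a) (b, b)) = fR (b, b) - fR (b, a)"
    "v (linepath (b, b) (a, b)) = fT (a, b) - fT (b, b)"
    "v (linepath (a, b) (a, a)) = fL (a, a) - fL (a, b)"
    using abc by (auto intro!: eB eR eT eL)
  ultimately show ?thesis by linarith
qed

text \<open>
  Each \<open>H\<^sub>i\<close> is a half space, and the \<open>q\<^sub>i\<close> are the corners of a small square around \<open>L\<close>, so \<open>w\<close> has
  trivial monodromy around \<open>L\<close>.
\<close>

definition flat_square :: "'a::real_normed_vector set \<Rightarrow> ((real \<Rightarrow> 'a) \<Rightarrow> real) \<Rightarrow> 'a set \<Rightarrow> 'a set \<Rightarrow> bool" where
  "flat_square A w L C \<longleftrightarrow>
     (\<exists>H1 H2 H3 H4 q1 q2 q3 q4.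
        (\<forall>H\<in>{H1, H2, H3, H4}. open H \<and> convex H) \<and> H1 \<inter> H3 = {} \<and> H2 \<inter> H4 = {} \<and>
        H1 \<union> H2 \<union> H3 \<union> H4 = - L \<and>
        q1 \<in> H4 \<inter> H1 \<and> q2 \<in> H1 \<inter> H2 \<and> q3 \<in> H2 \<inter> H3 \<and> q4 \<in> H3 \<inter> H4 \<and>
        closed_segment q1 q2 \<subseteq> C - A \<and> closed_segment q2 q3 \<subseteq> C - A \<and>
        closed_segment q3 q4 \<subseteq> C - A \<and> closed_segment q4 q1 \<subseteq> C - A \<and>
        w (linepath q1 q2) + w (linepath q2 q3) + w (linepath q3 q4) + w (linepath q4 q1) = 0)"

text \<open>
  By induction on the number of subspaces meeting \<open>C\<close>: the four half spaces around one of them cut \<open>C\<close>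
  into convex pieces meeting fewer subspaces. Their potentials can be normalised to agree on three
  of the four consecutive overlaps, and \<open>flat_square\<close> gives agreement on the fourth.
\<close>

lemma arrangement_potential:
  fixes \<L> :: "'a::real_normed_vector set set"
  assumes w: "path_cocycle (- \<Union>\<L>) w"
    and sq: "\<And>L D. L \<in> \<L> \<Longrightarrow> open D \<Longrightarrow> convex D \<Longrightarrow> D \<inter> L \<noteq> {} \<Longrightarrow> flat_square (\<Union>\<L>) w L D"
    and C: "open C" "convex C" "finite {L \<in> \<L>. L \<inter> C \<noteq> {}}"
  shows "path_connected (C - \<Union>\<L>) \<and> (\<exists>f. potential (C - \<Union>\<L>) w f)"
  using C
proof (induction "card {L \<in> \<L>. L \<inter> C \<noteq> {}}" arbitrary: C rule: less_induct)
  case less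
  show ?case
  proof (cases "\<exists>L\<in>\<L>. L \<inter> C \<noteq> {}")
    case False
    then have "C - \<Union>\<L> = C" by blast
    then show ?thesis
      using ex_potential_convex[OF w, of C] less.prems convex_imp_path_connected[of C] by auto
  next
    case True
    then obtain L where L: "L \<in> \<L>" "C \<inter> L \<noteq> {}" by blast
    from sq[OF L(1) less.prems(1,2) L(2)] obtain H1 H2 H3 H4 q1 q2 q3 q4 where
      H: "\<forall>H\<in>{H1, H2, H3, H4}. open H \<and> convex H" "H1 \<inter> H3 = {}" "H2 \<inter> H4 = {}"
        "H1 \<union> H2 \<union> H3 \<union> H4 = - L"
      and q: "q1 \<in> H4 \<inter> H1" "q2 \<in> H1 \<inter> H2" "q3 \<in> H2 \<inter> H3" "q4 \<in> H3 \<inter> H4"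
      and seg: "closed_segment q1 q2 \<subseteq> C - \<Union>\<L>" "closed_segment q2 q3 \<subseteq> C - \<Union>\<L>"
        "closed_segment q3 q4 \<subseteq> C - \<Union>\<L>" "closed_segment q4 q1 \<subseteq> C - \<Union>\<L>"
      and sum0: "w (linepath q1 q2) + w (linepath q2 q3) + w (linepath q3 q4) + w (linepath q4 q1) = 0"
      unfolding flat_square_def by - (elim exE conjE, rule that)
    have qC: "{q1, q2, q3, q4} \<subseteq> C - \<Union>\<L>"
      using seg ends_in_segment by blast
    \<comment> \<open>Any such \<open>D\<close> drops \<open>L\<close> from the subspaces that it
      meets, so the count decreases strictly.\<close>
    have IH: "path_connected (D - \<Union>\<L>) \<and> (\<exists>f. potential (D - \<Union>\<L>) w f)"
      if D: "open D" "convex D" "D \<subseteq> C" "D \<inter> L = {}" for D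
    proof (rule less.hyps[OF _ D(1,2)])
      have "{L \<in> \<L>. L \<inter> D \<noteq> {}} \<subset> {L \<in> \<L>. L \<inter> C \<noteq> {}}"
        using D L by blast
      then show "card {L \<in> \<L>. L \<inter> D \<noteq> {}} < card {L \<in> \<L>. L \<inter> C \<noteq> {}}"
        using less.prems(3) by (rule psubset_card_mono[rotated])
      show "finite {L \<in> \<L>. L \<inter> D \<noteq> {}}"
        by (rule finite_subset[OF _ less.prems(3)]) (use D in blast)
    qed
    have IHH: "path_connected (C \<inter> H - \<Union>\<L>) \<and> (\<exists>f. potential (C \<inter> H - \<Union>\<L>) w f)"
      if "H \<in> {H1, H2, H3, H4}" for H
      using bspec[OF H(1) that] H(4) that less.prems by (intro IH open_Int convex_Int) auto
    \<comment> \<open>Path connectedness is part of the induction because of these overlaps: two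
      potentials that agree at a corner \<open>q\<close> then agree on the whole overlap.\<close>
    have pc: "path_connected (C \<inter> H \<inter> K - \<Union>\<L>)" if "H \<in> {H1, H2, H3, H4}" "K \<in> {H1, H2, H3, H4}" for H K
      using bspec[OF H(1) that(1)] bspec[OF H(1) that(2)] H(4) that less.prems
      by (intro IH[THEN conjunct1] open_Int convex_Int) auto
    have CU: "C - \<Union>\<L> = (C \<inter> H1 - \<Union>\<L>) \<union> (C \<inter> H2 - \<Union>\<L>) \<union> (C \<inter> H3 - \<Union>\<L>) \<union> (C \<inter> H4 - \<Union>\<L>)"
    proof -
      have "- \<Union>\<L> \<subseteq> H1 \<union> H2 \<union> H3 \<union> H4" unfolding H(4) using L(1) by blast
      then show ?thesis by auto
    qed
    have IHH': "path_connected (C \<inter> H1 - \<Union>\<L>)" "path_connected (C \<inter> H2 - \<Union>\<L>)"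
        "path_connected (C \<inter> H3 - \<Union>\<L>)" "path_connected (C \<inter> H4 - \<Union>\<L>)"
      using IHH[of H1] IHH[of H2] IHH[of H3] IHH[of H4] by simp_all
    have ne: "(C \<inter> H1 - \<Union>\<L>) \<inter> (C \<inter> H2 - \<Union>\<L>) \<noteq> {}"
        "((C \<inter> H1 - \<Union>\<L>) \<union> (C \<inter> H2 - \<Union>\<L>)) \<inter> (C \<inter> H3 - \<Union>\<L>) \<noteq> {}"
        "((C \<inter> H1 - \<Union>\<L>) \<union> (C \<inter> H2 - \<Union>\<L>) \<union> (C \<inter> H3 - \<Union>\<L>)) \<inter> (C \<inter> H4 - \<Union>\<L>) \<noteq> {}"
      using q qC by blast+
    have "path_connected (C - \<Union>\<L>)"
      unfolding CU by (intro path_connected_Un IHH' ne)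
    moreover
    have "\<exists>g. potential (C \<inter> H1 - \<Union>\<L>) w g" "\<exists>g. potential (C \<inter> H2 - \<Union>\<L>) w g"
        "\<exists>g. potential (C \<inter> H3 - \<Union>\<L>) w g" "\<exists>g. potential (C \<inter> H4 - \<Union>\<L>) w g"
      using IHH[of H1] IHH[of H2] IHH[of H3] IHH[of H4] by simp_all
    then obtain g1 g2 g3 g4 where
      g: "potential (C \<inter> H1 - \<Union>\<L>) w g1" "potential (C \<inter> H2 - \<Union>\<L>) w g2"
        "potential (C \<inter> H3 - \<Union>\<L>) w g3" "potential (C \<inter> H4 - \<Union>\<L>) w g4"
      by blast
    have shift: "potential U w (\<lambda>x. f x + k)" if "potential U w f" for U f k
      using that by (simp add: potential_def)
    define f1 where "f1 = g1"
    define f2 where "f2 = (\<lambda>x. g2 x + (f1 q2 - g2 q2))"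
    define f3 where "f3 = (\<lambda>x. g3 x + (f2 q3 - g3 q3))"
    define f4 where "f4 = (\<lambda>x. g4 x + (f3 q4 - g4 q4))"
    have f: "potential (C \<inter> H1 - \<Union>\<L>) w f1" "potential (C \<inter> H2 - \<Union>\<L>) w f2"
        "potential (C \<inter> H3 - \<Union>\<L>) w f3" "potential (C \<inter> H4 - \<Union>\<L>) w f4"
      unfolding f1_def f2_def f3_def f4_def by (intro shift g)+
    have f_q: "f2 q2 = f1 q2" "f3 q3 = f2 q3" "f4 q4 = f3 q4"
      by (simp_all add: f2_def f3_def f4_def)
    have edge: "w (linepath x y) = h y - h x"
      if "potential (C \<inter> H - \<Union>\<L>) w h" "convex H" "x \<in> H" "y \<in> H" "closed_segment x y \<subseteq> C - \<Union>\<L>" for H h x y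
      using potentialD[OF that(1), of "linepath x y"] that closed_segment_subset[of x H y] by auto
    have "w (linepath q1 q2) = f1 q2 - f1 q1" "w (linepath q2 q3) = f2 q3 - f2 q2"
      "w (linepath q3 q4) = f3 q4 - f3 q3" "w (linepath q4 q1) = f4 q1 - f4 q4"
      using H(1) q seg by (auto intro!: edge[OF f(1)] edge[OF f(2)] edge[OF f(3)] edge[OF f(4)])
    with sum0 f_q have f_q1: "f4 q1 = f1 q1" by linarith
    have agree: "h x = k x"
      if "potential (C \<inter> H - \<Union>\<L>) w h" "potential (C \<inter> K - \<Union>\<L>) w k" "h q = k q"
        "H \<in> {H1, H2, H3, H4}" "K \<in> {H1, H2, H3, H4}" "q \<in> H \<inter> K" "q \<in> C - \<Union>\<L>" "x \<in> C - \<Union>\<L>" "x \<in> H \<inter> K"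
      for H K h k q x
      using potential_diff[OF that(1,2) pc[OF that(4,5)], of x q] that by auto
    have agrees: "f1 x = f2 x" if "x \<in> C - \<Union>\<L>" "x \<in> H1 \<inter> H2" for x
      using agree[OF f(1,2) f_q(1)[symmetric]] q qC that by blast
    have agrees2: "f2 x = f3 x" if "x \<in> C - \<Union>\<L>" "x \<in> H2 \<inter> H3" for x
      using agree[OF f(2,3) f_q(2)[symmetric]] q qC that by blast
    have agrees3: "f3 x = f4 x" if "x \<in> C - \<Union>\<L>" "x \<in> H3 \<inter> H4" for x
      using agree[OF f(3,4) f_q(3)[symmetric]] q qC that by blast
    have agrees4: "f4 x = f1 x" if "x \<in> C - \<Union>\<L>" "x \<in> H4 \<inter> H1" for x
      using agree[OF f(4,1) f_q1] q qC that by blast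
    \<comment> \<open>Opposite half spaces are disjoint, so the order of the cases matters only on
      the four consecutive overlaps, where the potentials agree.\<close>
    define F where "F x = (if x \<in> H1 then f1 x else if x \<in> H2 then f2 x else if x \<in> H3 then f3 x else f4 x)" for x
    have Fi: "\<forall>x\<in>C \<inter> H1 - \<Union>\<L>. F x = f1 x" "\<forall>x\<in>C \<inter> H2 - \<Union>\<L>. F x = f2 x"
        "\<forall>x\<in>C \<inter> H3 - \<Union>\<L>. F x = f3 x" "\<forall>x\<in>C \<inter> H4 - \<Union>\<L>. F x = f4 x"
      using agrees agrees2 agrees3 agrees4 H(2,3) by (auto simp: F_def)
    have cong: "potential U w F" if "potential U w f" "\<forall>x\<in>U. F x = f x" for U f
      using that by (simp add: potential_def) (metis pathfinish_in_path_image pathstart_in_path_image subsetD)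
    have "potential (C - \<Union>\<L>) w F"
    proof (rule potential_glue[OF w, where \<W> = "{H1, H2, H3, H4}"])
      show "C - \<Union>\<L> \<subseteq> \<Union>{H1, H2, H3, H4}" using H(4) L(1) by auto
      fix W assume W: "W \<in> {H1, H2, H3, H4}"
      have "potential (C \<inter> W - \<Union>\<L>) w F"
        using W cong[OF f(1) Fi(1)] cong[OF f(2) Fi(2)] cong[OF f(3) Fi(3)] cong[OF f(4) Fi(4)] by auto
      moreover have "(C - \<Union>\<L>) \<inter> W = C \<inter> W - \<Union>\<L>" by auto
      ultimately show "potential ((C - \<Union>\<L>) \<inter> W) w F" by simp
      show "open W" using bspec[OF H(1) W] by simp
    qed auto
    ultimately show ?thesis by blast
  qed
qed

lemma path_cocycle_pullback:
  assumes w: "path_cocycle T w" and h: "continuous_on S h" "h \<in> S \<rightarrow> T"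
  shows "path_cocycle S (\<lambda>g. w (h \<circ> g))"
  unfolding path_cocycle_def
proof (intro conjI allI impI)
  fix g k assume "homotopic_paths S g k"
  then show "w (h \<circ> g) = w (h \<circ> k)"
    using path_cocycle_homotopic[OF w] homotopic_paths_continuous_image h by blast
next
  fix g k
  assume "path g \<and> path k \<and> path_image g \<subseteq> S \<and> path_image k \<subseteq> S \<and> pathfinish g = pathstart k"
  moreover from this have "path (h \<circ> g)" "path (h \<circ> k)"
    using h by (auto intro!: path_continuous_image continuous_on_subset[OF h(1)])
  ultimately have "w ((h \<circ> g) +++ (h \<circ> k)) = w (h \<circ> g) + w (h \<circ> k)"
    using h(2) by (intro path_cocycle_join[OF w])
      (auto simp: path_image_compose pathstart_compose pathfinish_compose)
  then show "w (h \<circ> (g +++ k)) = w (h \<circ> g) + w (h \<circ> k)"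
    by (simp add: path_compose_join)
qed

section \<open>Flat surfaces and lifted configurations\<close>

text \<open>With \<open>\<sigma>\<close> equal to 1 for the torus and -1 for the Klein bottle, one
  family \<open>deck\<close> describes both deck groups.\<close>

definition twist :: "real \<Rightarrow> int \<Rightarrow> real" where
  "twist \<sigma> m = (if even m then 1 else \<sigma>)"

definition deck :: "real \<Rightarrow> int \<Rightarrow> int \<Rightarrow> real \<times> real \<Rightarrow> real \<times> real" where
  "deck \<sigma> k m z = (twist \<sigma> m * fst z + of_int k, snd z + of_int m)"

text \<open>Points move with pairwise distinct speeds \<open>e l\<close>. For each pair and each
  integer a single \<open>d\<close> is bad, so all but countably many \<open>d\<close> work.\<close>

lemma generic_perturbation:
  fixes y0 :: "'n::finite \<Rightarrow> real"
  assumes "0 < r"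
  shows "\<exists>y. (\<forall>l. \<bar>y l - y0 l\<bar> < r) \<and> (\<forall>l l'. l \<noteq> l' \<longrightarrow> y l - y l' \<notin> \<int>)"
proof -
  obtain f :: "'n \<Rightarrow> nat" where f: "inj f"
    using finite_imp_inj_to_nat_seg[of "UNIV :: 'n set"] by auto
  define e where "e l = 1 / (1 + real (f l))" for l
  have e: "0 < e l" "e l \<le> 1" for l by (auto simp: e_def)
  have inj: "e l \<noteq> e l'" if "l \<noteq> l'" for l l'
    using f that by (auto simp: e_def inj_def field_simps)
  define bad where "bad = (\<lambda>(l, l', N :: int). (of_int N - y0 l + y0 l') / (e l - e l')) ` UNIV"
  have "countable bad" unfolding bad_def by simp
  then obtain d where d: "d \<in> {0<..<r}" "d \<notin> bad"
    using real_interval_avoid_countable_set[OF assms] by blast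
  have "\<bar>d * e l\<bar> < r" for l
  proof -
    have "d * e l \<le> d" using d e[of l] by (intro mult_left_le) auto
    moreover have "0 < d * e l" using d e[of l] by simp
    ultimately show ?thesis using d by (simp only: greaterThanLessThan_iff abs_of_pos) linarith
  qed
  moreover have "(y0 l + d * e l) - (y0 l' + d * e l') \<notin> \<int>" if "l \<noteq> l'" for l l'
  proof
    assume "(y0 l + d * e l) - (y0 l' + d * e l') \<in> \<int>"
    then obtain N :: int where "(y0 l + d * e l) - (y0 l' + d * e l') = of_int N"
      by (elim Ints_cases)
    then have "d * (e l - e l') = of_int N - y0 l + y0 l'" by (simp add: algebra_simps)
    then have "d = (of_int N - y0 l + y0 l') / (e l - e l')"
      using inj[OF that] by (simp add: divide_simps)
    then have "d \<in> bad" unfolding bad_def by (intro image_eqI[of _ _ "(l, l', N)"]) auto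
    with d show False by simp
  qed
  ultimately show ?thesis by (intro exI[of _ "\<lambda>l. y0 l + d * e l"]) simp
qed

lemma open_vec_box:
  fixes D :: "((real \<times> real) ^ 'n::finite) set"
  assumes "open D" "z0 \<in> D"
  obtains r where "0 < r"
    "\<And>z. (\<And>l. \<bar>fst (z $ l) - fst (z0 $ l)\<bar> < r \<and> \<bar>snd (z $ l) - snd (z0 $ l)\<bar> < r) \<Longrightarrow> z \<in> D"
proof -
  obtain e where e: "0 < e" "ball z0 e \<subseteq> D"
    using assms open_contains_ball by blast
  define N where "N = real (CARD('n))"
  have N: "N > 0" by (simp add: N_def)
  show thesis
  \<comment> \<open>There are \<open>2 * N\<close> real coordinates, and the distance is at most the
    sum of the coordinate distances.\<close>
  proof (rule that[of "e / (2 * N)"])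
    show "0 < e / (2 * N)" using e N by simp
    fix z :: "(real \<times> real) ^ 'n"
    assume z: "\<And>l. \<bar>fst (z $ l) - fst (z0 $ l)\<bar> < e / (2 * N) \<and> \<bar>snd (z $ l) - snd (z0 $ l)\<bar> < e / (2 * N)"
    have "dist (z $ l) (z0 $ l) < e / N" for l
    proof -
      have "dist (z $ l) (z0 $ l) \<le> \<bar>fst (z $ l) - fst (z0 $ l)\<bar> + \<bar>snd (z $ l) - snd (z0 $ l)\<bar>"
        unfolding dist_prod_def dist_real_def by (rule order_trans[OF sqrt_sum_squares_le_sum_abs]) simp
      also have "\<dots> < e / (2 * N) + e / (2 * N)" using z[of l] by linarith
      also have "\<dots> = e / N" using N by (simp add: field_simps)
      finally show ?thesis .
    qed
    then have "(\<Sum>l\<in>UNIV. dist (z $ l) (z0 $ l)) < (\<Sum>l\<in>(UNIV :: 'n set). e / N)"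
      by (intro sum_strict_mono) auto
    also have "\<dots> = e" using N by (simp add: N_def)
    finally have "dist z z0 < e"
      unfolding dist_vec_def using L2_set_le_sum[of UNIV "\<lambda>l. dist (z $ l) (z0 $ l)"] by simp
    then show "z \<in> D" using e by (auto simp: dist_commute)
  qed
qed

lemma convex_affine_positive:
  fixes f :: "'a::real_vector \<Rightarrow> real"
  assumes "\<And>x y u v. u + v = 1 \<Longrightarrow> f (u *\<^sub>R x + v *\<^sub>R y) = u * f x + v * f y"
  shows "convex {z. 0 < f z}" "convex {z. f z < 0}"
proof -
  have *: "0 < u * a + v * b" if "0 < a" "0 < b" "0 \<le> u" "0 \<le> v" "u + v = 1" for u v a b :: real
    using that by (cases "u = 0") (auto intro: add_pos_nonneg)
  show "convex {z. 0 < f z}"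
    unfolding convex_def by (auto simp: assms intro!: *)
  have "u * a + v * b < 0" if "a < 0" "b < 0" "0 \<le> u" "0 \<le> v" "u + v = 1" for u v a b :: real
    using *[of "-a" "-b" u v] that by simp
  then show "convex {z. f z < 0}"
    unfolding convex_def by (auto simp: assms)
qed

locale flat_surface =
  fixes p :: "real \<times> real \<Rightarrow> 'm::topological_space" and \<sigma> :: real
  assumes sign: "\<sigma> = 1 \<or> \<sigma> = - 1"
    and p_eq_iff: "p z = p w \<longleftrightarrow> (\<exists>k m. w = deck \<sigma> k m z)"
    and surj_p: "surj p"
    and open_iff: "open U \<longleftrightarrow> open (p -` U)"
begin

lemma continuous_p: "continuous_on A p"
  by (rule continuous_on_subset[OF _ subset_UNIV])
    (simp add: continuous_on_open_vimage open_iff[symmetric])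

lemma p_deck [simp]: "p (deck \<sigma> k m z) = p z"
  using p_eq_iff by metis

lemma twist_square [simp]: "twist \<sigma> m * twist \<sigma> m = 1" "twist \<sigma> m * (twist \<sigma> m * x) = x"
  using sign by (auto simp: twist_def)

section \<open>The arrangement of coincidence subspaces\<close>

definition project :: "(real \<times> real) ^ 'n \<Rightarrow> 'm ^ 'n" where
  "project z = (\<chi> i. p (z $ i))"

definition coincidence :: "'n \<Rightarrow> 'n \<Rightarrow> int \<Rightarrow> int \<Rightarrow> ((real \<times> real) ^ 'n) set" where
  "coincidence i j k m = {z. z $ j = deck \<sigma> k m (z $ i)}"

definition coincidences :: "((real \<times> real) ^ 'n) set set" where
  "coincidences = {coincidence i j k m | i j k m. i \<noteq> j}"

lemma continuous_project: "continuous_on A project"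
  unfolding project_def
  by (intro continuous_on_vec_lambda continuous_on_compose2[OF continuous_p[of UNIV]] continuous_intros) auto

lemma project_in_config_space_iff: "project z \<in> config_space \<longleftrightarrow> z \<notin> \<Union>coincidences"
proof -
  have "z \<in> \<Union>coincidences \<longleftrightarrow> (\<exists>i j. i \<noteq> j \<and> (\<exists>k m. z $ j = deck \<sigma> k m (z $ i)))"
    unfolding coincidences_def coincidence_def by blast
  also have "\<dots> \<longleftrightarrow> (\<exists>i j. i \<noteq> j \<and> p (z $ i) = p (z $ j))"
    by (simp add: p_eq_iff)
  finally show ?thesis by (auto simp: config_space_def project_def)
qed

text \<open>A point of \<open>coincidence i j k m\<close> determines \<open>k\<close> and
  \<open>m\<close> from its coordinates, up to the sign \<open>twist \<sigma> m\<close>; hence both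
  are bounded by \<open>2 * R\<close>.\<close>

lemma finite_coincidences:
  fixes C :: "((real \<times> real) ^ 'n::finite) set"
  assumes "bounded C"
  shows "finite {L \<in> coincidences. L \<inter> C \<noteq> {}}"
proof -
  obtain R where R: "\<And>z. z \<in> C \<Longrightarrow> norm z \<le> R"
    using assms by (auto simp: bounded_iff)
  define N where "N = \<lceil>2 * R\<rceil>"
  have "{L \<in> coincidences. L \<inter> C \<noteq> {}} \<subseteq>
      (\<lambda>(i, j, k, m). coincidence i j k m) ` (UNIV \<times> UNIV \<times> {-N..N} \<times> {-N..N})"
  proof
    fix L :: "((real \<times> real) ^ 'n) set"
    assume "L \<in> {L \<in> coincidences. L \<inter> C \<noteq> {}}"
    then obtain z where "L \<in> coincidences" and z: "z \<in> L" "z \<in> C" by blast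
    then obtain i j k m where L: "L = coincidence i j k m"
      by (auto simp: coincidences_def)
    have "norm (z $ l) \<le> R" for l
      using R[OF z(2)] Finite_Cartesian_Product.norm_nth_le[of z l] by linarith
    then have b: "\<bar>fst (z $ l)\<bar> \<le> R" "\<bar>snd (z $ l)\<bar> \<le> R" for l
      using norm_fst_le[of "fst (z $ l)" "snd (z $ l)"] norm_snd_le[of "snd (z $ l)" "fst (z $ l)"]
      by (auto intro: order_trans)
    have "z $ j = deck \<sigma> k m (z $ i)" using z L by (simp add: coincidence_def)
    then have "of_int k = fst (z $ j) - twist \<sigma> m * fst (z $ i)" "of_int m = snd (z $ j) - snd (z $ i)"
      by (auto simp: deck_def)
    moreover have "\<bar>twist \<sigma> m * fst (z $ i)\<bar> \<le> R" using b[of i] sign by (auto simp: twist_def)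
    ultimately have "\<bar>real_of_int k\<bar> \<le> 2 * R" "\<bar>real_of_int m\<bar> \<le> 2 * R"
      using b[of i] b[of j] by linarith+
    moreover have "2 * R \<le> of_int N" by (simp add: N_def)
    ultimately have "real_of_int (- N) \<le> of_int k" "real_of_int k \<le> of_int N"
        "real_of_int (- N) \<le> of_int m" "real_of_int m \<le> of_int N"
      unfolding abs_le_iff of_int_minus by linarith+
    then have "k \<in> {-N..N}" "m \<in> {-N..N}"
      unfolding of_int_le_iff by simp_all
    then show "L \<in> (\<lambda>(i, j, k, m). coincidence i j k m) ` (UNIV \<times> UNIV \<times> {-N..N} \<times> {-N..N})"
      by (intro image_eqI[of _ _ "(i, j, k, m)"]) (auto simp: L)
  qed
  then show ?thesis by (rule finite_subset) simp
qed

lemma p_eqE: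
  assumes "p (x, y) = p (x', y')"
  obtains k m :: int where "x' = twist \<sigma> m * x + of_int k" "y' = y + of_int m"
  using assms by (auto simp: p_eq_iff deck_def)

text \<open>
  The string \<open>i\<close> moves along \<open>(x0 + s, y i)\<close> and the string \<open>j\<close> along the image of
  \<open>(x0 + t * d, y i + t)\<close>. The slope \<open>d\<close> is chosen so that the latter closes up in the surface between
  \<open>t = - \<epsilon>\<close> and \<open>t = 1 - \<epsilon>\<close>; on the Klein bottle a vertical line would not. The other strings are put
  in general position, so that the two moving strings only meet each other, at \<open>s = t = 0\<close>.
\<close>

lemma flat_square_coincidence:
  fixes w :: "(real \<Rightarrow> 'm ^ 'n::finite) \<Rightarrow> real"
  assumes w: "path_cocycle config_space w" and L: "L \<in> coincidences"
    and D: "open D" "convex D" "D \<inter> L \<noteq> {}"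
  shows "flat_square (\<Union>coincidences) (\<lambda>g. w (project \<circ> g)) L D"
proof -
  obtain i j k m where ij: "i \<noteq> j" and Leq: "L = coincidence i j k m"
    using L by (auto simp: coincidences_def)
  obtain z0 where z0: "z0 \<in> D" "z0 \<in> L" using D by blast
  obtain r where r: "0 < r"
    "\<And>z. (\<And>l. \<bar>fst (z $ l) - fst (z0 $ l)\<bar> < r \<and> \<bar>snd (z $ l) - snd (z0 $ l)\<bar> < r) \<Longrightarrow> z \<in> D"
    using open_vec_box[OF D(1) z0(1)] by blast
  define x0 where "x0 = fst (z0 $ i)"
  \<comment> \<open>The slope \<open>d\<close> below depends on \<open>\<epsilon>\<close>, so its
    bound must come first: \<open>\<epsilon> \<le> 1 / 4\<close> keeps the denominator of
    \<open>d\<close> at least 1/2, whence \<open>\<bar>d\<bar> \<le> 4 * \<bar>x0\<bar>\<close>. The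
    other term then keeps displacements by \<open>\<epsilon>\<close> and by
    \<open>\<epsilon> * d\<close> below \<open>r / 4\<close>.\<close>
  define \<epsilon> where "\<epsilon> = min (1 / 4) (r / (4 * (4 * \<bar>x0\<bar> + 1)))"
  have \<epsilon>: "0 < \<epsilon>" "\<epsilon> \<le> 1 / 4"
  proof -
    show "0 < \<epsilon>" using r(1) by (auto simp: \<epsilon>_def)
    show "\<epsilon> \<le> 1 / 4" unfolding \<epsilon>_def by (rule min.cobounded1)
  qed
  have \<epsilon>r: "\<epsilon> * (4 * \<bar>x0\<bar> + 1) \<le> r / 4"
  proof -
    have "\<epsilon> * (4 * \<bar>x0\<bar> + 1) \<le> (r / (4 * (4 * \<bar>x0\<bar> + 1))) * (4 * \<bar>x0\<bar> + 1)"
      by (intro mult_right_mono) (auto simp: \<epsilon>_def)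
    also have "\<dots> = r / 4" by (simp add: field_simps add_nonneg_eq_0_iff)
    finally show ?thesis .
  qed
  have \<epsilon>r1: "\<epsilon> \<le> r / 4" "\<epsilon> * (4 * \<bar>x0\<bar>) \<le> r / 4"
  proof -
    have "0 \<le> \<epsilon> * (4 * \<bar>x0\<bar>)" using \<epsilon> by simp
    then show "\<epsilon> \<le> r / 4" "\<epsilon> * (4 * \<bar>x0\<bar>) \<le> r / 4" using \<epsilon>r \<epsilon>(1) unfolding distrib_left mult_1_right by linarith+
  qed
  \<comment> \<open>The solution of
    \<open>x0 + (1 - \<epsilon>) * d = \<sigma> * (x0 - \<epsilon> * d)\<close>:
    \<open>deck \<sigma> 0 1\<close> takes the point at \<open>t = - \<epsilon>\<close> to the one
    at \<open>t = 1 - \<epsilon>\<close>. On the torus \<open>d\<close> is 0.\<close>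
  define d where "d = (\<sigma> - 1) * x0 / (1 - \<epsilon> + \<sigma> * \<epsilon>)"
  have d: "d * (1 - \<epsilon> + \<sigma> * \<epsilon>) = (\<sigma> - 1) * x0"
    using sign \<epsilon> by (auto simp: d_def)
  have d_le: "\<bar>d\<bar> \<le> 4 * \<bar>x0\<bar>"
  proof (cases "\<sigma> = 1")
    case False
    then have "\<sigma> = - 1" using sign by simp
    then have "\<bar>d\<bar> * (1 - 2 * \<epsilon>) = 2 * \<bar>x0\<bar>"
      using arg_cong[OF d, of abs] \<epsilon> by (simp add: abs_mult)
    moreover have "\<bar>d\<bar> * (1 / 2) \<le> \<bar>d\<bar> * (1 - 2 * \<epsilon>)"
      using \<epsilon> by (intro mult_left_mono) auto
    ultimately show ?thesis by linarith
  qed (simp add: d_def)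
  obtain y where y: "\<And>l. \<bar>y l - snd (z0 $ l)\<bar> < r / 2" "\<And>l l'. l \<noteq> l' \<Longrightarrow> y l - y l' \<notin> \<int>"
    using generic_perturbation[of "r / 2" "\<lambda>l. snd (z0 $ l)"] r by auto
  \<comment> \<open>String \<open>j\<close> reaches the height \<open>y l\<close> modulo 1 only at
    the times \<open>y l - y i - m'\<close>; these are the abscissae of the lifts of its position
    there. String \<open>i\<close> is kept away from the resting strings by the heights
    alone.\<close>
  define bad where "bad l = (\<lambda>(k', m' :: int). twist \<sigma> m' * (x0 + (y l - y i - of_int m') * d) + of_int k') ` (UNIV :: (int \<times> int) set)" for l
  have "\<exists>x. \<bar>x - fst (z0 $ l)\<bar> < r \<and> x \<notin> bad l" for l
  proof -
    have "countable (bad l)" by (simp add: bad_def)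
    then obtain x where "x \<in> {fst (z0 $ l)<..<fst (z0 $ l) + r}" "x \<notin> bad l"
      using real_interval_avoid_countable_set[of "fst (z0 $ l)" "fst (z0 $ l) + r" "bad l"] r(1) by auto
    then show ?thesis by (intro exI[of _ x]) auto
  qed
  then obtain x where x: "\<And>l. \<bar>x l - fst (z0 $ l)\<bar> < r" "\<And>l. x l \<notin> bad l" by metis
  \<comment> \<open>Applying \<open>deck \<sigma> k m\<close> to the second moving point selects the
    sheet on which \<open>Z 0\<close> lies in \<open>L\<close>.\<close>
  define Z :: "real \<times> real \<Rightarrow> (real \<times> real) ^ 'n" where
    "Z u = (\<chi> l. if l = i then (x0 + fst u, y i)
                 else if l = j then deck \<sigma> k m (x0 + snd u * d, y i + snd u) else (x l, y l))" for u
  have Zi: "Z u $ i = (x0 + fst u, y i)"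
    and Zj: "Z u $ j = deck \<sigma> k m (x0 + snd u * d, y i + snd u)"
    and Zl: "l \<noteq> i \<Longrightarrow> l \<noteq> j \<Longrightarrow> Z u $ l = (x l, y l)" for u l
    using ij by (auto simp: Z_def)
  have z0j: "fst (z0 $ j) = twist \<sigma> m * x0 + k" "snd (z0 $ j) = snd (z0 $ i) + m"
    using z0(2) by (auto simp: Leq coincidence_def deck_def x0_def)
  let ?a = "- \<epsilon>" and ?b = \<epsilon> and ?c = "1 - \<epsilon>"
  have ZD: "Z u \<in> D" if u: "u \<in> {?a..?b} \<times> {?a..?b}" for u
  proof (rule r(2))
    fix l
    have u': "\<bar>fst u\<bar> \<le> \<epsilon>" "\<bar>snd u\<bar> \<le> \<epsilon>" using u by auto
    have "\<bar>snd u\<bar> * \<bar>d\<bar> \<le> \<epsilon> * (4 * \<bar>x0\<bar>)"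
      using u' d_le \<epsilon> by (intro mult_mono) auto
    then have "\<bar>snd u * d\<bar> \<le> r / 4" using \<epsilon>r1 by (simp add: abs_mult)
    moreover have "\<bar>twist \<sigma> m * (snd u * d)\<bar> = \<bar>snd u * d\<bar>"
      using sign by (auto simp: twist_def)
    ultimately have "\<bar>twist \<sigma> m * (snd u * d)\<bar> < r" using r(1) by linarith
    moreover have "\<bar>y i + snd u - snd (z0 $ i)\<bar> < r" "\<bar>fst u\<bar> < r" "\<bar>y i - snd (z0 $ i)\<bar> < r"
      using y(1)[of i] u' \<epsilon>r1 r(1) by linarith+
    moreover have "\<bar>x l - fst (z0 $ l)\<bar> < r" "\<bar>y l - snd (z0 $ l)\<bar> < r"
      using x(1)[of l] y(1)[of l] r(1) by linarith+
    ultimately show "\<bar>fst (Z u $ l) - fst (z0 $ l)\<bar> < r \<and> \<bar>snd (Z u $ l) - snd (z0 $ l)\<bar> < r"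
      using Zl[of l u]
      by (cases "l = i"; cases "l = j")
        (auto simp: Zi Zj z0j deck_def x0_def[symmetric] distrib_left algebra_simps)
  qed
  \<comment> \<open>Both parameters are below 1 in absolute value, so being an integer means being
    0. A meeting of \<open>i\<close> and \<open>j\<close> thus forces \<open>u = 0\<close>, the
    puncture.\<close>
  have ZX: "project (Z u) \<in> config_space" if u: "u \<in> {?a..?c} \<times> {?a..?c} - {0}" for u
  proof -
    have b: "\<bar>fst u\<bar> < 1" "\<bar>snd u\<bar> < 1" using u \<epsilon> by auto
    have int0: "s = 0" if "s = of_int n" "\<bar>s\<bar> < 1" for s :: real and n :: int
    proof -
      have "real_of_int \<bar>n\<bar> < 1" using that by simp
      then have "n = 0" unfolding of_int_less_1_iff by simp
      with that show ?thesis by simp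
    qed
    have 1: "p (Z u $ l) \<noteq> p (Z u $ l')" if "l \<noteq> l'" "l \<noteq> j" "l' \<noteq> j" for l l'
    proof
      assume "p (Z u $ l) = p (Z u $ l')"
      then have "p (fst (Z u $ l), y l) = p (fst (Z u $ l'), y l')"
        using that Zl[of l u] Zl[of l' u] by (cases "l = i"; cases "l' = i") (auto simp: Zi)
      then obtain m' :: int where "y l' = y l + m'" by (rule p_eqE)
      then have "y l' - y l \<in> \<int>" by simp
      with y(2)[of l' l] that show False by simp
    qed
    have 2: "p (Z u $ j) \<noteq> p (Z u $ l)" if l: "l \<noteq> i" "l \<noteq> j" for l
    proof
      assume "p (Z u $ j) = p (Z u $ l)"
      then have "p (x0 + snd u * d, y i + snd u) = p (x l, y l)"
        using Zl[OF l, of u] by (simp add: Zj)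
      then obtain k' m' :: int where
        km: "x l = twist \<sigma> m' * (x0 + snd u * d) + k'" "y l = y i + snd u + m'" by (rule p_eqE)
      then have "snd u = y l - y i - m'" by simp
      with km(1) have "x l \<in> bad l"
        unfolding bad_def by (intro image_eqI[of _ _ "(k', m')"]) auto
      with x(2) show False by blast
    qed
    have 3: "p (Z u $ i) \<noteq> p (Z u $ j)"
    proof
      assume "p (Z u $ i) = p (Z u $ j)"
      then have "p (x0 + fst u, y i) = p (x0 + snd u * d, y i + snd u)"
        by (simp add: Zi Zj)
      then obtain k' m' :: int where
        km: "x0 + snd u * d = twist \<sigma> m' * (x0 + fst u) + k'" "y i + snd u = y i + m'" by (rule p_eqE)
      then have s0: "snd u = 0" using int0[of "snd u" m'] b by simp
      with km(2) have "m' = 0" by simp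
      with km(1) s0 have "fst u = of_int (- k')" by (simp add: twist_def)
      then have "fst u = 0" using int0 b by blast
      with s0 u show False by (auto simp: prod_eq_iff)
    qed
    have "p (Z u $ l) \<noteq> p (Z u $ l')" if "l \<noteq> l'" for l l'
      using 1[OF that] 2[of l] 2[of l'] 3 that by metis
    then show ?thesis by (simp add: config_space_def project_def)
  qed
  have Zlin: "Z \<circ> linepath u v = linepath (Z u) (Z v)" for u v
    by (auto simp: fun_eq_iff vec_eq_iff Z_def linepath_def deck_def algebra_simps)
  have contZ: "continuous_on A Z" for A
    unfolding Z_def deck_def
  proof (rule continuous_on_vec_lambda)
    fix l
    show "continuous_on A (\<lambda>u. if l = i then (x0 + fst u, y i)
        else if l = j then (twist \<sigma> m * fst (x0 + snd u * d, y i + snd u) + real_of_int k,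
          snd (x0 + snd u * d, y i + snd u) + real_of_int m) else (x l, y l))"
      by (cases "l = i"; cases "l = j") (auto intro!: continuous_intros)
  qed
  have cyc: "path_cocycle ({?a..?c} \<times> {?a..?c} - {0}) (\<lambda>g. w ((project \<circ> Z) \<circ> g))"
    using ZX by (intro path_cocycle_pullback[OF w] continuous_on_compose contZ continuous_project) auto
  \<comment> \<open>Opposite sides of the period square have equal projections, so the family
    factors through a torus with one puncture, and the small square runs around this
    puncture.\<close>
  have "project (Z (s, ?a)) = project (Z (s, ?c))" for s
  proof -
    have "(x0 + ?c * d, y i + ?c) = deck \<sigma> 0 1 (x0 + ?a * d, y i + ?a)"
      using d by (simp add: deck_def twist_def algebra_simps)
    then have "p (x0 + ?c * d, y i + ?c) = p (x0 + ?a * d, y i + ?a)" by simp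
    then have "p (Z (s, ?a) $ l) = p (Z (s, ?c) $ l)" for l
      using Zl[of l "(s, ?a)"] Zl[of l "(s, ?c)"]
      by (cases "l = i"; cases "l = j") (simp_all add: Zi Zj)
    then show ?thesis by (simp add: project_def)
  qed
  then have hor: "w ((project \<circ> Z) \<circ> linepath (?a, ?a) (?c, ?a)) = w ((project \<circ> Z) \<circ> linepath (?a, ?c) (?c, ?c))"
    by (intro arg_cong[of _ _ w]) (auto simp: linepath_def fun_eq_iff algebra_simps)
  have "project (Z (?a, t)) = project (Z (?c, t))" for t
  proof -
    have "(x0 + ?c, y i) = deck \<sigma> 1 0 (x0 + ?a, y i)"
      by (simp add: deck_def twist_def)
    then have "p (x0 + ?c, y i) = p (x0 + ?a, y i)" by simp
    then have "p (Z (?a, t) $ l) = p (Z (?c, t) $ l)" for l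
      using Zl[of l "(?a, t)"] Zl[of l "(?c, t)"]
      by (cases "l = i"; cases "l = j") (simp_all add: Zi Zj)
    then show ?thesis by (simp add: project_def)
  qed
  then have ver: "w ((project \<circ> Z) \<circ> linepath (?a, ?a) (?a, ?c)) = w ((project \<circ> Z) \<circ> linepath (?c, ?a) (?c, ?c))"
    by (intro arg_cong[of _ _ w]) (auto simp: linepath_def fun_eq_iff algebra_simps)
  have "w ((project \<circ> Z) \<circ> linepath (?a, ?a) (?b, ?a)) + w ((project \<circ> Z) \<circ> linepath (?b, ?a) (?b, ?b)) +
      w ((project \<circ> Z) \<circ> linepath (?b, ?b) (?a, ?b)) + w ((project \<circ> Z) \<circ> linepath (?a, ?b) (?a, ?a)) = 0"
    using \<epsilon> by (intro small_square_zero[OF cyc _ _ _ hor ver]) auto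
  then have sum0: "w (project \<circ> linepath (Z (?a, ?a)) (Z (?b, ?a))) + w (project \<circ> linepath (Z (?b, ?a)) (Z (?b, ?b))) +
      w (project \<circ> linepath (Z (?b, ?b)) (Z (?a, ?b))) + w (project \<circ> linepath (Z (?a, ?b)) (Z (?a, ?a))) = 0"
    by (simp add: comp_assoc Zlin)
  have seg: "closed_segment (Z u) (Z v) \<subseteq> D - \<Union>coincidences"
    if "convex A" "A \<subseteq> {?a..?b} \<times> {?a..?b} - {0}" "u \<in> A" "v \<in> A" for A u v
  proof -
    have "closed_segment (Z u) (Z v) = Z ` closed_segment u v"
      using Zlin[of u v] path_image_compose[of Z "linepath u v"] by simp
    also have "closed_segment u v \<subseteq> A" using that by (simp add: closed_segment_subset)
    finally have "closed_segment (Z u) (Z v) \<subseteq> Z ` A" by blast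
    moreover have "A \<subseteq> {?a..?c} \<times> {?a..?c} - {0}" using that(2) \<epsilon> by force
    ultimately show ?thesis
      using that(2) ZD ZX project_in_config_space_iff by blast
  qed
  \<comment> \<open>Affine functions that recover the parameters \<open>snd u\<close> and
    \<open>fst u\<close> from \<open>Z u\<close> and whose common zero set is \<open>L\<close>. The
    term \<open>T z * d\<close> in \<open>S\<close> compensates the slanted motion of string
    \<open>j\<close>.\<close>
  define T where "T z = snd (z $ j) - of_int m - snd (z $ i)" for z :: "(real \<times> real) ^ 'n"
  define S where "S z = T z * d + fst (z $ i) - twist \<sigma> m * (fst (z $ j) - of_int k)" for z
  have aff: "T (u *\<^sub>R z + v *\<^sub>R z') = u * T z + v * T z'" "S (u *\<^sub>R z + v *\<^sub>R z') = u * S z + v * S z'"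
    if "u + v = 1" for z z' u v
  proof -
    have v: "v = 1 - u" using that by simp
    show "T (u *\<^sub>R z + v *\<^sub>R z') = u * T z + v * T z'" "S (u *\<^sub>R z + v *\<^sub>R z') = u * S z + v * S z'"
      unfolding v S_def T_def by (simp_all add: algebra_simps)
  qed
  have contT: "continuous_on UNIV T" and contS: "continuous_on UNIV S"
    unfolding S_def T_def by (intro continuous_intros)+
  have ZT: "T (Z u) = snd u" "S (Z u) = fst u" for u
    by (simp_all add: T_def S_def Zi Zj deck_def)
  let ?H1 = "{z. T z < 0}" and ?H2 = "{z. 0 < S z}" and ?H3 = "{z. 0 < T z}" and ?H4 = "{z. S z < 0}"
  have HL: "?H1 \<union> ?H2 \<union> ?H3 \<union> ?H4 = - L"
  proof -
    have "z \<in> L \<longleftrightarrow> T z = 0 \<and> S z = 0" for z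
    proof -
      have "z \<in> L \<longleftrightarrow> T z = 0 \<and> fst (z $ j) = twist \<sigma> m * fst (z $ i) + of_int k"
        by (auto simp: Leq coincidence_def deck_def T_def prod_eq_iff)
      also have "\<dots> \<longleftrightarrow> T z = 0 \<and> S z = 0"
      proof -
        have "twist \<sigma> m = 1 \<or> twist \<sigma> m = - 1" using sign by (auto simp: twist_def)
        then have "fst (z $ j) = twist \<sigma> m * fst (z $ i) + of_int k \<longleftrightarrow>
            fst (z $ i) - twist \<sigma> m * (fst (z $ j) - of_int k) = 0"
          by (elim disjE; simp; argo)
        moreover have "S z = fst (z $ i) - twist \<sigma> m * (fst (z $ j) - of_int k)" if "T z = 0"
          using that by (simp add: S_def)
        ultimately show ?thesis by metis
      qed
      finally show ?thesis .
    qed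
    then have "- L = {z. T z \<noteq> 0} \<union> {z. S z \<noteq> 0}" by blast
    also have "\<dots> = ?H1 \<union> ?H2 \<union> ?H3 \<union> ?H4" by (auto simp only: linorder_neq_iff)
    finally show ?thesis ..
  qed
  show ?thesis
    unfolding flat_square_def
  proof (intro exI conjI)
    show "\<forall>H\<in>{?H1, ?H2, ?H3, ?H4}. open H \<and> convex H"
      using convex_affine_positive[of T, OF aff(1)] convex_affine_positive[of S, OF aff(2)]
        open_Collect_less[OF contT continuous_on_const[of _ 0]] open_Collect_less[OF continuous_on_const[of _ 0] contT]
        open_Collect_less[OF contS continuous_on_const[of _ 0]] open_Collect_less[OF continuous_on_const[of _ 0] contS]
      by simp
    show "?H1 \<union> ?H2 \<union> ?H3 \<union> ?H4 = - L" by (rule HL)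
    show "Z (?a, ?a) \<in> ?H4 \<inter> ?H1" "Z (?b, ?a) \<in> ?H1 \<inter> ?H2" "Z (?b, ?b) \<in> ?H2 \<inter> ?H3" "Z (?a, ?b) \<in> ?H3 \<inter> ?H4"
      using \<epsilon> by (auto simp: ZT)
    show "closed_segment (Z (?a, ?a)) (Z (?b, ?a)) \<subseteq> D - \<Union>coincidences"
      using \<epsilon> by (intro seg[of "{?a..?b} \<times> {?a}"] convex_Times) (auto simp: zero_prod_def)
    show "closed_segment (Z (?b, ?a)) (Z (?b, ?b)) \<subseteq> D - \<Union>coincidences"
      using \<epsilon> by (intro seg[of "{?b} \<times> {?a..?b}"] convex_Times) (auto simp: zero_prod_def)
    show "closed_segment (Z (?b, ?b)) (Z (?a, ?b)) \<subseteq> D - \<Union>coincidences"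
      using \<epsilon> by (intro seg[of "{?a..?b} \<times> {?b}"] convex_Times) (auto simp: zero_prod_def)
    show "closed_segment (Z (?a, ?b)) (Z (?a, ?a)) \<subseteq> D - \<Union>coincidences"
      using \<epsilon> by (intro seg[of "{?a} \<times> {?a..?b}"] convex_Times) (auto simp: zero_prod_def)
  qed (use sum0 in auto)
qed

end

section \<open>Characters of fundamental groups and change of base point\<close>

lemma homotopic_paths_lid_const:
  fixes g :: "real \<Rightarrow> 'a::topological_space"
  assumes "path g" "path_image g \<subseteq> S"
  shows "homotopic_paths S ((\<lambda>_. pathstart g) +++ g) g"
proof -
  let ?e = "linepath 0 1 :: real \<Rightarrow> real"
  have e: "path ?e" "path_image ?e \<subseteq> {0..1}"
    by (auto simp: closed_segment_eq_real_ivl)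
  have c: "continuous_on {0..1} g" "g \<in> {0..1} \<rightarrow> S"
    using assms by (auto simp: path_def path_image_def)
  have "homotopic_paths S (g \<circ> (linepath 0 0 +++ ?e)) (g \<circ> ?e)"
    using homotopic_paths_lid[OF e] c by (intro homotopic_paths_continuous_image) auto
  moreover have "g \<circ> (linepath 0 0 +++ ?e) = (\<lambda>_. pathstart g) +++ g"
    by (auto simp: joinpaths_def linepath_def pathstart_def)
  moreover have "g \<circ> ?e = g" by (auto simp: linepath_def)
  ultimately show ?thesis by simp
qed

lemma homotopic_paths_rid_const:
  fixes g :: "real \<Rightarrow> 'a::topological_space"
  assumes "path g" "path_image g \<subseteq> S"
  shows "homotopic_paths S (g +++ (\<lambda>_. pathfinish g)) g"
proof -
  let ?e = "linepath 0 1 :: real \<Rightarrow> real"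
  have e: "path ?e" "path_image ?e \<subseteq> {0..1}"
    by (auto simp: closed_segment_eq_real_ivl)
  have c: "continuous_on {0..1} g" "g \<in> {0..1} \<rightarrow> S"
    using assms by (auto simp: path_def path_image_def)
  have "homotopic_paths S (g \<circ> (?e +++ linepath 1 1)) (g \<circ> ?e)"
    using homotopic_paths_rid[OF e] c by (intro homotopic_paths_continuous_image) auto
  moreover have "g \<circ> (?e +++ linepath 1 1) = g +++ (\<lambda>_. pathfinish g)"
    by (auto simp: joinpaths_def linepath_def pathfinish_def)
  moreover have "g \<circ> ?e = g" by (auto simp: linepath_def)
  ultimately show ?thesis by simp
qed

section \<open>Transport of paths along connecting paths\<close>

definition path_in :: "'a::topological_space set \<Rightarrow> (real \<Rightarrow> 'a) \<Rightarrow> 'a \<Rightarrow> 'a \<Rightarrow> bool" where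
  "path_in S g a b \<longleftrightarrow> path g \<and> path_image g \<subseteq> S \<and> pathstart g = a \<and> pathfinish g = b"

lemma path_in_join: "path_in S g a b \<Longrightarrow> path_in S h b c \<Longrightarrow> path_in S (g +++ h) a c"
  by (auto simp: path_in_def path_image_join)

lemma path_in_reversepath: "path_in S g a b \<Longrightarrow> path_in S (reversepath g) b a"
  by (auto simp: path_in_def)

lemma path_in_loop_iff: "path_in S g a a \<longleftrightarrow> g \<in> based_loops S a"
  by (auto simp: path_in_def based_loops_def)

lemma homotopic_assoc:
  assumes "path_in S g a b" "path_in S h b c" "path_in S k c d"
  shows "homotopic_paths S ((g +++ h) +++ k) (g +++ (h +++ k))"
  using assms unfolding path_in_def
  by (intro homotopic_paths_sym[OF homotopic_paths_assoc]) auto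

lemma homotopic_cancel_left:
  assumes c: "path_in S c a b" and k: "path_in S k b d"
  shows "homotopic_paths S (reversepath c +++ (c +++ k)) k"
proof -
  note c' = path_in_reversepath[OF c]
  have "homotopic_paths S (reversepath c +++ (c +++ k)) ((reversepath c +++ c) +++ k)"
    by (rule homotopic_paths_sym[OF homotopic_assoc[OF c' c k]])
  also have "homotopic_paths S ((reversepath c +++ c) +++ k) ((\<lambda>_. b) +++ k)"
    using homotopic_paths_rinv_const[of "reversepath c" S] c k
    by (intro homotopic_paths_join) (auto simp: path_in_def)
  also have "homotopic_paths S ((\<lambda>_. b) +++ k) k"
    using homotopic_paths_lid_const[of k S] k by (auto simp: path_in_def)
  finally show ?thesis .
qed

lemma homotopic_join_left:
  assumes "path_in S c a b" "path_in S k b d" "homotopic_paths S k l"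
  shows "homotopic_paths S (c +++ k) (c +++ l)"
  using assms by (intro homotopic_paths_join) (auto simp: path_in_def)

lemma homotopic_join_right:
  assumes "path_in S c a b" "path_in S k b d" "homotopic_paths S c l"
  shows "homotopic_paths S (c +++ k) (l +++ k)"
  using assms by (intro homotopic_paths_join) (auto simp: path_in_def)

text \<open>The inner \<open>reversepath c2 +++ c2\<close> cancels. Separate connecting paths at the
  three points serve the extension of a character to paths; the change of base point is the case of
  three equal ones.\<close>

lemma homotopic_transport_join:
  assumes c1: "path_in S c1 o1 x" and c2: "path_in S c2 o2 y" and c3: "path_in S c3 o3 z"
    and g: "path_in S g x y" and h: "path_in S h y z"
  shows "homotopic_paths S (c1 +++ ((g +++ h) +++ reversepath c3))
           ((c1 +++ (g +++ reversepath c2)) +++ (c2 +++ (h +++ reversepath c3)))"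
proof (rule homotopic_paths_sym)
  note r2 = path_in_reversepath[OF c2] and r3 = path_in_reversepath[OF c3]
  note hr = path_in_join[OF h r3]
  have "homotopic_paths S ((c1 +++ (g +++ reversepath c2)) +++ (c2 +++ (h +++ reversepath c3)))
     (c1 +++ ((g +++ reversepath c2) +++ (c2 +++ (h +++ reversepath c3))))"
    by (rule homotopic_assoc[OF c1 path_in_join[OF g r2] path_in_join[OF c2 hr]])
  also have "homotopic_paths S \<dots> (c1 +++ (g +++ (reversepath c2 +++ (c2 +++ (h +++ reversepath c3)))))"
    by (rule homotopic_join_left[OF c1 path_in_join[OF path_in_join[OF g r2] path_in_join[OF c2 hr]]
          homotopic_assoc[OF g r2 path_in_join[OF c2 hr]]])
  also have "homotopic_paths S \<dots> (c1 +++ (g +++ (h +++ reversepath c3)))"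
    by (rule homotopic_join_left[OF c1 path_in_join[OF g path_in_join[OF r2 path_in_join[OF c2 hr]]]
          homotopic_join_left[OF g path_in_join[OF r2 path_in_join[OF c2 hr]] homotopic_cancel_left[OF c2 hr]]])
  also have "homotopic_paths S \<dots> (c1 +++ ((g +++ h) +++ reversepath c3))"
    by (rule homotopic_join_left[OF c1 path_in_join[OF g hr] homotopic_paths_sym[OF homotopic_assoc[OF g h r3]]])
  finally show "homotopic_paths S ((c1 +++ (g +++ reversepath c2)) +++ (c2 +++ (h +++ reversepath c3)))
     (c1 +++ ((g +++ h) +++ reversepath c3))" .
qed

lemma homotopic_transport_cong:
  assumes c: "path_in S c a x" and d: "path_in S d b y" and g: "path_in S g x y" and gh: "homotopic_paths S g h"
  shows "homotopic_paths S (c +++ (g +++ reversepath d)) (c +++ (h +++ reversepath d))"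
  by (rule homotopic_join_left[OF c path_in_join[OF g path_in_reversepath[OF d]]
        homotopic_join_right[OF g path_in_reversepath[OF d] gh]])

text \<open>Conjugation by \<open>c\<close> is undone by conjugation with its reverse. Applied to
  \<open>c\<close> this gives injectivity of the change of base point, applied to
  \<open>reversepath c\<close> surjectivity.\<close>

lemma homotopic_transport_back:
  assumes c: "path_in S c a b" and k: "path_in S k b b"
  shows "homotopic_paths S (reversepath c +++ ((c +++ (k +++ reversepath c)) +++ c)) k"
proof -
  note r = path_in_reversepath[OF c]
  note kr = path_in_join[OF k r]
  have "homotopic_paths S (reversepath c +++ ((c +++ (k +++ reversepath c)) +++ c))
      (reversepath c +++ (c +++ ((k +++ reversepath c) +++ c)))"
    by (rule homotopic_join_left[OF r path_in_join[OF path_in_join[OF c kr] c] homotopic_assoc[OF c kr c]])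
  also have "homotopic_paths S \<dots> ((k +++ reversepath c) +++ c)"
    by (rule homotopic_cancel_left[OF c path_in_join[OF kr c]])
  also have "homotopic_paths S \<dots> (k +++ (reversepath c +++ c))"
    by (rule homotopic_assoc[OF k r c])
  also have "homotopic_paths S \<dots> (k +++ (\<lambda>_. b))"
    using homotopic_paths_rinv_const[of "reversepath c" S] c
    by (intro homotopic_join_left[OF k path_in_join[OF r c]]) (auto simp: path_in_def)
  also have "homotopic_paths S \<dots> k"
    using homotopic_paths_rid_const[of k S] k by (auto simp: path_in_def)
  finally show ?thesis .
qed

lemma carrier_fundamental_group: "carrier (fundamental_group S a) = path_class S ` based_loops S a"
  by (simp add: fundamental_group_def)

lemma path_class_eq_iff:
  assumes "g \<in> based_loops S a"
  shows "path_class S g = path_class S h \<longleftrightarrow> homotopic_paths S g h"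
proof
  assume eq: "path_class S g = path_class S h"
  have "g \<in> path_class S g" using assms by (auto simp: path_class_def based_loops_def)
  with eq have "homotopic_paths S h g" by (simp add: path_class_def)
  then show "homotopic_paths S g h" by (rule homotopic_paths_sym)
qed (rule path_class_eqI)

text \<open>Paths are closed up to loops at \<open>a\<close> by chosen paths \<open>c x\<close>. The
  extension depends on this choice, but its values on loops at \<open>a\<close> do not.\<close>

lemma hom_extends_to_path_cocycle:
  assumes S: "path_connected S" "a \<in> S" and u: "u \<in> hom (fundamental_group S a) additive_reals"
  shows "\<exists>w. path_cocycle S w \<and> (\<forall>g\<in>based_loops S a. w g = u (path_class S g))"
proof -
  have "\<forall>x\<in>S. \<exists>g. path_in S g a x"
    using S unfolding path_connected_def path_in_def by blast
  then obtain c where c: "\<And>x. x \<in> S \<Longrightarrow> path_in S (c x) a x" by metis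
  define t where "t g = c (pathstart g) +++ (g +++ reversepath (c (pathfinish g)))" for g
  define w where "w g = u (path_class S (t g))" for g
  have u_mult: "u (path_class S (g +++ h)) = u (path_class S g) + u (path_class S h)"
    if "g \<in> based_loops S a" "h \<in> based_loops S a" for g h
    using hom_mult[OF u, of "path_class S g" "path_class S h"] that
    by (simp add: carrier_fundamental_group fundamental_group_mult additive_reals_def)
  have ends: "path_in S g (pathstart g) (pathfinish g)" "pathstart g \<in> S" "pathfinish g \<in> S"
    if "path g" "path_image g \<subseteq> S" for g
    using that by (auto simp: path_in_def)
  have t_loop: "t g \<in> based_loops S a" if "path g" "path_image g \<subseteq> S" for g
    unfolding t_def path_in_loop_iff[symmetric]
    by (intro path_in_join[OF c] path_in_join[OF ends(1)] path_in_reversepath[OF c] ends that)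
  have join: "w (g +++ h) = w g + w h"
    if gh: "path g" "path h" "path_image g \<subseteq> S" "path_image h \<subseteq> S" "pathfinish g = pathstart h" for g h
  proof -
    have g: "path_in S g (pathstart g) (pathstart h)" using ends(1)[of g] gh by simp
    have h: "path_in S h (pathstart h) (pathfinish h)" using ends(1)[of h] gh by simp
    have "pathstart g \<in> S" "pathstart h \<in> S" "pathfinish h \<in> S" using ends gh by auto
    from homotopic_transport_join[OF this[THEN c] g h]
    have "homotopic_paths S (t (g +++ h)) (t g +++ t h)"
      by (simp add: t_def gh(5))
    then show ?thesis
      unfolding w_def using path_class_eqI u_mult t_loop gh by metis
  qed
  have "path_cocycle S w"
    unfolding path_cocycle_def
  proof (intro conjI allI impI)
    fix g h assume gh: "homotopic_paths S g h"
    have g: "path g" "path_image g \<subseteq> S"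
      using homotopic_paths_imp_path[OF gh] homotopic_paths_imp_subset[OF gh] by auto
    have "homotopic_paths S (t g) (t h)"
      unfolding t_def homotopic_paths_imp_pathstart[OF gh, symmetric] homotopic_paths_imp_pathfinish[OF gh, symmetric]
      by (intro homotopic_transport_cong[OF c c] ends g gh)
    then show "w g = w h" unfolding w_def using path_class_eqI by metis
  qed (use join in auto)
  \<comment> \<open>The chosen \<open>c a\<close> may be a nontrivial loop, so \<open>w\<close>
    evaluates a conjugate of \<open>g\<close>; the target being commutative, the conjugation is
    invisible.\<close>
  moreover have "w g = u (path_class S g)" if g: "g \<in> based_loops S a" for g
  proof -
    note ca = c[OF S(2)]
    have l: "c a \<in> based_loops S a" using ca by (simp add: path_in_loop_iff)
    then have rl: "reversepath (c a) \<in> based_loops S a" using path_in_reversepath[OF ca] by (simp add: path_in_loop_iff)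
    have gl: "g +++ reversepath (c a) \<in> based_loops S a"
      using g rl path_in_join path_in_loop_iff by metis
    have const: "(\<lambda>_. a) \<in> based_loops S a"
      using S by (auto simp: based_loops_def path_image_def pathstart_def pathfinish_def)
    have "u (path_class S (\<lambda>_. a)) = 0"
      using u_mult[OF const const] by (simp add: joinpaths_def)
    moreover have "path_class S (c a +++ reversepath (c a)) = path_class S (\<lambda>_. a)"
      using homotopic_paths_rinv_const[of "c a" S] ca by (intro path_class_eqI) (auto simp: path_in_def)
    ultimately have "u (path_class S (c a)) + u (path_class S (reversepath (c a))) = 0"
      using u_mult[OF l rl] by simp
    moreover have "pathstart g = a" "pathfinish g = a" using g by (auto simp: based_loops_def)
    then have "w g = u (path_class S (c a)) + (u (path_class S g) + u (path_class S (reversepath (c a))))"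
      using u_mult[OF l gl] u_mult[OF g rl] by (simp add: w_def t_def)
    ultimately show ?thesis by simp
  qed
  ultimately show ?thesis by blast
qed

text \<open>\<open>T\<close> moves the base point, so its effect on loops is brought back to
  \<open>a\<close> by conjugation with \<open>c\<close>. The explicit formula for
  \<open>\<phi>\<close> is kept because cocycles are evaluated on it later.\<close>

lemma homeomorphism_change_base_iso:
  assumes T: "homeomorphism S S T T'" and a: "a \<in> S" and c: "path_in S c a (T a)"
  shows "\<exists>\<phi>\<in>iso (fundamental_group S a) (fundamental_group S a).
    \<forall>g\<in>based_loops S a. \<phi> (path_class S g) = path_class S (c +++ ((T \<circ> g) +++ reversepath c))"
proof -
  let ?G = "fundamental_group S a"
  define t where "t g = c +++ ((T \<circ> g) +++ reversepath c)" for g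
  have cT: "continuous_on S T" "T \<in> S \<rightarrow> S" and cT': "continuous_on S T'" "T' \<in> S \<rightarrow> S"
    and TT': "\<And>x. x \<in> S \<Longrightarrow> T (T' x) = x" "\<And>x. x \<in> S \<Longrightarrow> T' (T x) = x"
    using T by (auto simp: homeomorphism_def)
  have image: "path_in S (f \<circ> g) (f x) (f y)"
    if "path_in S g x y" "continuous_on S f" "f \<in> S \<rightarrow> S" for f g x y
  proof -
    have "path (f \<circ> g)"
      using that by (intro path_continuous_image continuous_on_subset[OF that(2)]) (auto simp: path_in_def)
    moreover have "path_image (f \<circ> g) \<subseteq> S"
      using that(1,3) by (auto simp: path_in_def path_image_compose)
    ultimately show ?thesis
      using that(1) by (simp add: path_in_def pathstart_compose pathfinish_compose)
  qed
  have Tg: "path_in S (T \<circ> g) (T a) (T a)" if "g \<in> based_loops S a" for g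
    using image[of g a a, OF _ cT] that by (simp add: path_in_loop_iff)
  have t_loop: "t g \<in> based_loops S a" if "g \<in> based_loops S a" for g
    unfolding t_def path_in_loop_iff[symmetric]
    by (intro path_in_join[OF c] path_in_join[OF Tg] path_in_reversepath[OF c] that)
  have t_cong: "homotopic_paths S (t g) (t h)" if "g \<in> based_loops S a" "homotopic_paths S g h" for g h
    unfolding t_def
    by (rule homotopic_transport_cong[OF c c Tg[OF that(1)] homotopic_paths_continuous_image[OF that(2) cT]])
  \<comment> \<open>A representative is picked from each class; \<open>t_cong\<close> makes the
    choice immaterial.\<close>
  define \<phi> where "\<phi> A = path_class S (t (SOME g. g \<in> based_loops S a \<and> path_class S g = A))" for A
  have \<phi>: "\<phi> (path_class S g) = path_class S (t g)" if g: "g \<in> based_loops S a" for g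
  proof -
    let ?h = "SOME h. h \<in> based_loops S a \<and> path_class S h = path_class S g"
    have h: "?h \<in> based_loops S a \<and> path_class S ?h = path_class S g"
      by (rule someI[of "\<lambda>h. h \<in> based_loops S a \<and> path_class S h = path_class S g" g]) (simp add: g)
    then have "homotopic_paths S ?h g" using path_class_eq_iff[of ?h S a g] by blast
    then show ?thesis unfolding \<phi>_def by (rule path_class_eqI[OF t_cong[OF conjunct1[OF h]]])
  qed
  have join: "g +++ h \<in> based_loops S a" if "g \<in> based_loops S a" "h \<in> based_loops S a" for g h
    using that path_in_join path_in_loop_iff by metis
  have "\<phi> \<in> hom ?G ?G"
  proof (rule homI)
    fix A assume "A \<in> carrier ?G"
    then show "\<phi> A \<in> carrier ?G" using \<phi> t_loop by (auto simp: carrier_fundamental_group)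
  next
    fix A B assume "A \<in> carrier ?G" "B \<in> carrier ?G"
    then obtain g h where gh: "g \<in> based_loops S a" "h \<in> based_loops S a"
      and AB: "A = path_class S g" "B = path_class S h"
      by (auto simp: carrier_fundamental_group)
    have "homotopic_paths S (t (g +++ h)) (t g +++ t h)"
      unfolding t_def path_compose_join
      by (rule homotopic_transport_join[OF c c c Tg Tg]) (use gh in auto)
    then have "path_class S (t (g +++ h)) = path_class S (t g +++ t h)"
      by (rule path_class_eqI)
    then show "\<phi> (A \<otimes>\<^bsub>?G\<^esub> B) = \<phi> A \<otimes>\<^bsub>?G\<^esub> \<phi> B"
      using gh by (simp add: AB fundamental_group_mult \<phi> join t_loop)
  qed
  moreover have "inj_on \<phi> (carrier ?G)"
  proof (rule inj_onI)
    fix A B assume "A \<in> carrier ?G" "B \<in> carrier ?G" and eq: "\<phi> A = \<phi> B"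
    then obtain g h where gh: "g \<in> based_loops S a" "h \<in> based_loops S a"
      and AB: "A = path_class S g" "B = path_class S h"
      by (auto simp: carrier_fundamental_group)
    note r = path_in_reversepath[OF c]
    have recover: "homotopic_paths S (reversepath c +++ (t k +++ c)) (T \<circ> k)" if "k \<in> based_loops S a" for k
      unfolding t_def by (rule homotopic_transport_back[OF c Tg[OF that]])
    have tg: "path_in S (t g) a a" using t_loop gh by (simp add: path_in_loop_iff)
    have "homotopic_paths S (t g) (t h)"
      using eq gh path_class_eq_iff[OF t_loop] by (simp add: AB \<phi>)
    then have "homotopic_paths S (reversepath c +++ (t g +++ c)) (reversepath c +++ (t h +++ c))"
      by (rule homotopic_join_left[OF r path_in_join[OF tg c] homotopic_join_right[OF tg c]])
    then have "homotopic_paths S (T \<circ> g) (T \<circ> h)"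
      using recover gh homotopic_paths_sym homotopic_paths_trans by metis
    then have "homotopic_paths S (T' \<circ> (T \<circ> g)) (T' \<circ> (T \<circ> h))"
      by (rule homotopic_paths_continuous_image[OF _ cT'])
    moreover have "homotopic_paths S k (T' \<circ> (T \<circ> k))" if "k \<in> based_loops S a" for k
    proof (rule homotopic_paths_eq)
      show "k s = (T' \<circ> (T \<circ> k)) s" if "s \<in> {0..1}" for s
      proof -
        have "k s \<in> S"
          using \<open>k \<in> based_loops S a\<close> that by (auto simp: based_loops_def path_image_def)
        then show ?thesis using TT'(2) by simp
      qed
    qed (use that in \<open>auto simp: based_loops_def\<close>)
    ultimately have "homotopic_paths S g h"
      using gh homotopic_paths_sym homotopic_paths_trans by metis
    then show "A = B" unfolding AB by (rule path_class_eqI)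
  qed
  moreover have "carrier ?G \<subseteq> \<phi> ` carrier ?G"
  proof
    fix A assume "A \<in> carrier ?G"
    then obtain k where k: "k \<in> based_loops S a" and A: "A = path_class S k"
      by (auto simp: carrier_fundamental_group)
    note r = path_in_reversepath[OF c]
    have kk: "path_in S k a a" using k by (simp add: path_in_loop_iff)
    \<comment> \<open>A preimage of the class of \<open>k\<close>: carry \<open>k\<close> to the
      base point \<open>T a\<close>, then undo \<open>T\<close>.\<close>
    let ?l = "reversepath c +++ (k +++ c)"
    have l: "path_in S ?l (T a) (T a)" by (intro path_in_join[OF r] path_in_join[OF kk] c)
    have g: "T' \<circ> ?l \<in> based_loops S a"
      using image[OF l cT'] a TT' by (simp add: path_in_loop_iff)
    have "homotopic_paths S ?l (T \<circ> (T' \<circ> ?l))"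
    proof (rule homotopic_paths_eq)
      show "?l s = (T \<circ> (T' \<circ> ?l)) s" if "s \<in> {0..1}" for s
      proof -
        have "?l s \<in> S" using l that unfolding path_in_def path_image_def by blast
        then show ?thesis using TT'(1) by simp
      qed
    qed (use l in \<open>auto simp: path_in_def\<close>)
    then have "homotopic_paths S (c +++ (?l +++ reversepath c)) (t (T' \<circ> ?l))"
      unfolding t_def by (rule homotopic_transport_cong[OF c c l])
    moreover have "homotopic_paths S (c +++ (?l +++ reversepath c)) k"
      using homotopic_transport_back[OF r kk] by simp
    ultimately have "homotopic_paths S k (t (T' \<circ> ?l))"
      using homotopic_paths_sym homotopic_paths_trans by metis
    then have "A = \<phi> (path_class S (T' \<circ> ?l))"
      unfolding A \<phi>[OF g] by (rule path_class_eqI)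
    then show "A \<in> \<phi> ` carrier ?G" using g by (auto simp: carrier_fundamental_group)
  qed
  moreover have "\<phi> ` carrier ?G \<subseteq> carrier ?G"
    using \<phi> t_loop by (auto simp: carrier_fundamental_group)
  ultimately have "\<phi> \<in> iso ?G ?G" by (auto simp: iso_def bij_betw_def)
  with \<phi> show ?thesis unfolding t_def by blast
qed

section \<open>Lifting loops and evaluating characters\<close>

context flat_surface
begin

text \<open>The arrangement is infinite, but only finitely many subspaces meet a ball. Two points
  lie in a common ball, and so does a loop by compactness; hence connectedness and vanishing on
  loops pass to the whole complement.\<close>

lemma lifted_config_potential:
  fixes w :: "(real \<Rightarrow> 'm ^ 'n::finite) \<Rightarrow> real"
  assumes w: "path_cocycle config_space w"
  shows "path_connected (- \<Union>coincidences :: ((real \<times> real) ^ 'n) set)"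
    and "\<exists>f. potential (- \<Union>coincidences) (\<lambda>g. w (project \<circ> g)) f"
proof -
  let ?C = "\<Union>coincidences :: ((real \<times> real) ^ 'n) set" and ?X = "- \<Union>coincidences :: ((real \<times> real) ^ 'n) set" and ?v = "\<lambda>g. w (project \<circ> g)"
  have v: "path_cocycle ?X ?v"
    using w by (rule path_cocycle_pullback) (auto simp: continuous_project project_in_config_space_iff)
  have ball: "path_connected (ball 0 R - ?C) \<and> (\<exists>f. potential (ball 0 R - ?C) ?v f)" for R
    by (intro arrangement_potential[OF v flat_square_coincidence[OF w]] finite_coincidences) auto
  show pc: "path_connected ?X"
    unfolding path_connected_def
  proof (intro ballI)
    fix x y assume "x \<in> ?X" "y \<in> ?X"
    moreover define R where "R = norm x + norm y + 1"
    then have "x \<in> ball 0 R" "y \<in> ball 0 R" by (simp_all add: add_nonneg_pos)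
    ultimately have "x \<in> ball 0 R - ?C" "y \<in> ball 0 R - ?C" by auto
    then obtain g where "path g" "path_image g \<subseteq> ball 0 R - ?C" "pathstart g = x" "pathfinish g = y"
      using ball[of R] unfolding path_connected_def by blast
    then show "\<exists>g. path g \<and> path_image g \<subseteq> ?X \<and> pathstart g = x \<and> pathfinish g = y" by blast
  qed
  show "\<exists>f. potential ?X ?v f"
  proof (rule ex_potential[OF v order_refl pc])
    fix g assume g: "path g" "path_image g \<subseteq> ?X" "pathfinish g = pathstart g"
    obtain R where "path_image g \<subseteq> ball 0 R"
      using bounded_subset_ballD[OF compact_imp_bounded[OF compact_path_image[OF g(1)]]] by blast
    with g have "path_image g \<subseteq> ball 0 R - ?C" by blast
    with ball[of R] potentialD g show "?v g = 0" by fastforce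
  qed
qed

lemma project_surj: "\<exists>z. project z = x"
proof -
  have "\<forall>i. \<exists>z. p z = x $ i" using surj_p by (metis surjD)
  then obtain z where "\<And>i. p (z i) = x $ i" by metis
  then have "project (\<chi> i. z i) = x" by (simp add: project_def vec_eq_iff)
  then show ?thesis by blast
qed

lemma path_connected_config_space: "path_connected (config_space :: ('m ^ 'n::finite) set)"
proof -
  \<comment> \<open>Connectedness of the complement was obtained in the presence of a cocycle; the
    zero one serves here.\<close>
  have "path_cocycle (config_space :: ('m ^ 'n) set) (\<lambda>_. 0)"
    by (simp add: path_cocycle_def)
  then have "path_connected (project ` (- \<Union>coincidences :: ((real \<times> real) ^ 'n) set))"
    by (intro path_connected_continuous_image continuous_project lifted_config_potential(1))
  moreover have "project ` (- \<Union>coincidences :: ((real \<times> real) ^ 'n) set) = config_space"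
  proof
    show "config_space \<subseteq> project ` (- \<Union>coincidences :: ((real \<times> real) ^ 'n) set)"
    proof
      fix x :: "'m ^ 'n" assume "x \<in> config_space"
      moreover obtain z where "project z = x" using project_surj by blast
      ultimately show "x \<in> project ` (- \<Union>coincidences)" using project_in_config_space_iff by auto
    qed
  qed (auto simp: project_in_config_space_iff)
  ultimately show ?thesis by simp
qed

section \<open>Lifting of maps along the covering \<open>p\<close>\<close>

lemma continuous_deck: "continuous_on A (deck \<sigma> k m)"
  unfolding deck_def by (intro continuous_intros)

text \<open>A nontrivial deck transformation displaces every point by at least 1: in height if
  \<open>m\<close> is not 0, and otherwise as a horizontal translation by \<open>k\<close>.\<close>

lemma close_lifts_eq:
  assumes "p z = p z'" "dist z z' < 1"
  shows "z = z'"
proof -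
  obtain k m where z': "z' = deck \<sigma> k m z" using assms(1) p_eq_iff by blast
  have "\<bar>snd z' - snd z\<bar> < 1" "\<bar>fst z' - fst z\<bar> < 1"
    using assms(2) dist_fst_le[of z z'] dist_snd_le[of z z'] by (auto simp: dist_real_def)
  then have "real_of_int \<bar>m\<bar> < 1" by (simp add: z' deck_def)
  then have m: "m = 0" unfolding of_int_less_1_iff by simp
  with \<open>\<bar>fst z' - fst z\<bar> < 1\<close> have "real_of_int \<bar>k\<bar> < 1" by (simp add: z' deck_def twist_def)
  then have "k = 0" unfolding of_int_less_1_iff by simp
  with m show ?thesis by (simp add: z' deck_def twist_def)
qed

text \<open>The distance between two lifts is everywhere 0 or at least 1; on a connected domain it
  cannot jump, as it would have to take the value 1/2.\<close>

lemma lift_unique: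
  fixes f g :: "'b::topological_space \<Rightarrow> real \<times> real"
  assumes D: "connected D" and f: "continuous_on D f" and g: "continuous_on D g"
    and eq: "\<And>y. y \<in> D \<Longrightarrow> p (f y) = p (g y)" and x: "x \<in> D" "f x = g x" and y: "y \<in> D"
  shows "f y = g y"
proof (rule ccontr)
  assume "f y \<noteq> g y"
  then have far: "1 \<le> dist (f y) (g y)" using close_lifts_eq[OF eq[OF y]] by force
  have conn: "connected ((\<lambda>y. dist (f y) (g y)) ` D)"
    by (rule connected_continuous_image[OF continuous_on_dist[OF f g] D])
  have "dist (f x) (g x) = 0" using x(2) by simp
  then have zero: "0 \<in> (\<lambda>y. dist (f y) (g y)) ` D"
    using x(1) by (intro image_eqI[of _ _ x]) simp_all
  have "1 / 2 \<in> (\<lambda>y. dist (f y) (g y)) ` D"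
    by (rule connectedD_interval[OF conn zero imageI[OF y]]) (use far in auto)
  then obtain z where "z \<in> D" "dist (f z) (g z) = 1 / 2" by (elim imageE) simp
  with close_lifts_eq[OF eq[of z]] show False by simp
qed

text \<open>A ball of radius 1/2 has points less than 1 apart, so \<open>p\<close> is injective on
  it and, being open, has a continuous inverse on its image. A deck transformation makes this
  section pass through any prescribed point over \<open>V\<close>.\<close>

lemma local_section:
  obtains V where "open V" "y \<in> V"
    "\<And>z. p z \<in> V \<Longrightarrow> \<exists>s. continuous_on V s \<and> (\<forall>v\<in>V. p (s v) = v) \<and> s (p z) = z"
proof -
  obtain z1 where z1: "p z1 = y" using surj_p by (metis surjD)
  define B where "B = ball z1 (1 / 2)"
  have open_map: "open (p ` U)" if "open U" for U
  proof -
    have "p -` (p ` U) = (\<Union>k m. deck \<sigma> k m -` U)"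
    proof (intro subset_antisym subsetI)
      fix z assume "z \<in> p -` (p ` U)"
      then obtain u where "u \<in> U" "p z = p u" by auto
      then show "z \<in> (\<Union>k m. deck \<sigma> k m -` U)" using p_eq_iff by auto
    next
      fix z assume "z \<in> (\<Union>k m. deck \<sigma> k m -` U)"
      then obtain k m where "deck \<sigma> k m z \<in> U" by auto
      then have "p (deck \<sigma> k m z) \<in> p ` U" by blast
      then show "z \<in> p -` (p ` U)" by simp
    qed
    moreover have "open (deck \<sigma> k m -` U)" for k m
      using that continuous_deck[of UNIV] by (simp add: continuous_on_open_vimage)
    ultimately have "open (p -` (p ` U))" by (simp add: open_UN)
    then show ?thesis using open_iff by blast
  qed
  have inj: "inj_on p B"
  proof (rule inj_onI)
    fix z z' assume "z \<in> B" "z' \<in> B" "p z = p z'"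
    moreover from this have "dist z z' < 1"
      unfolding B_def using dist_triangle_half_r[of z1 z 1 z'] by (simp add: dist_commute)
    ultimately show "z = z'" using close_lifts_eq by blast
  qed
  define V where "V = p ` B"
  define s0 where "s0 = inv_into B p"
  have s0: "s0 v \<in> B" "p (s0 v) = v" if "v \<in> V" for v
    using that by (auto simp: V_def s0_def inv_into_into f_inv_into_f)
  have V: "open V" unfolding V_def B_def by (intro open_map) simp
  have cont: "continuous_on V s0"
    unfolding continuous_on_open_invariant
  proof (intro allI impI)
    fix U :: "(real \<times> real) set" assume "open U"
    moreover have "p ` (U \<inter> B) \<inter> V = s0 -` U \<inter> V"
    proof (intro subset_antisym subsetI)
      fix v assume "v \<in> p ` (U \<inter> B) \<inter> V"
      then show "v \<in> s0 -` U \<inter> V" by (auto simp: s0_def inv_into_f_f[OF inj])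
    next
      fix v assume "v \<in> s0 -` U \<inter> V"
      then have "s0 v \<in> U \<inter> B" "v = p (s0 v)" "v \<in> V" using s0 by auto
      then show "v \<in> p ` (U \<inter> B) \<inter> V" by blast
    qed
    ultimately show "\<exists>A. open A \<and> A \<inter> V = s0 -` U \<inter> V"
      using open_map[of "U \<inter> B"] by (intro exI[of _ "p ` (U \<inter> B)"]) (auto simp: B_def)
  qed
  show thesis
  proof (rule that[OF V])
    show "y \<in> V" unfolding V_def B_def using z1 by (auto intro!: image_eqI[of _ _ z1])
    fix z assume z: "p z \<in> V"
    then have "p (s0 (p z)) = p z" using s0 by blast
    then obtain k m where km: "z = deck \<sigma> k m (s0 (p z))" using p_eq_iff by blast
    have "continuous_on V (deck \<sigma> k m \<circ> s0)"
      by (intro continuous_on_compose cont continuous_deck)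
    with km s0 show "\<exists>s. continuous_on V s \<and> (\<forall>v\<in>V. p (s v) = v) \<and> s (p z) = z"
      by (intro exI[of _ "deck \<sigma> k m \<circ> s0"]) auto
  qed
qed

text \<open>Prescribing the lift at an arbitrary point of \<open>D\<close>, not at one base point,
  makes the property pass to unions.\<close>

definition liftable :: "('b::topological_space \<Rightarrow> 'm) \<Rightarrow> 'b set \<Rightarrow> bool" where
  "liftable h D \<longleftrightarrow>
     (\<forall>x\<in>D. \<forall>z. p z = h x \<longrightarrow>
        (\<exists>f. continuous_on D f \<and> (\<forall>y\<in>D. p (f y) = h y) \<and> f x = z))"

text \<open>The lift over the second set is started at a common point with the value of the first
  lift; \<open>lift_unique\<close> then gives agreement on the connected intersection.\<close>

lemma liftable_Un:
  assumes A: "liftable h A" "closed A" and B: "liftable h B" "closed B"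
    and AB: "connected (A \<inter> B)" "A \<inter> B \<noteq> {}"
  shows "liftable h (A \<union> B)"
proof -
  have *: "\<exists>f. continuous_on (A \<union> B) f \<and> (\<forall>y\<in>A \<union> B. p (f y) = h y) \<and> f x = z"
    if A: "liftable h A" "closed A" and B: "liftable h B" "closed B"
      and AB: "connected (A \<inter> B)" "A \<inter> B \<noteq> {}" and x: "x \<in> A" "p z = h x" for A B x z
  proof -
    obtain f where f: "continuous_on A f" "\<forall>y\<in>A. p (f y) = h y" "f x = z"
      using A(1) x unfolding liftable_def by blast
    obtain c where c: "c \<in> A" "c \<in> B" using AB(2) by blast
    then have "p (f c) = h c" using f by blast
    then obtain g where g: "continuous_on B g" "\<forall>y\<in>B. p (g y) = h y" "g c = f c"
      using B(1) c unfolding liftable_def by blast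
    have agree: "f y = g y" if "y \<in> A \<inter> B" for y
    proof (rule lift_unique[OF AB(1) continuous_on_subset[OF f(1)] continuous_on_subset[OF g(1)]])
      show "p (f y) = p (g y)" if "y \<in> A \<inter> B" for y using that f(2) g(2) by simp
      show "c \<in> A \<inter> B" using c by blast
    qed (use g(3) that in auto)
    have "continuous_on (A \<union> B) (\<lambda>y. if y \<in> A then f y else g y)"
      using agree by (intro continuous_on_cases A B f g) auto
    then show ?thesis
      using f g x(1) by (intro exI[of _ "\<lambda>y. if y \<in> A then f y else g y"]) auto
  qed
  show ?thesis
    unfolding liftable_def
  proof (intro ballI allI impI)
    fix x z assume "x \<in> A \<union> B" and z: "p z = h x"
    then consider "x \<in> A" | "x \<in> B" by blast
    then show "\<exists>f. continuous_on (A \<union> B) f \<and> (\<forall>y\<in>A \<union> B. p (f y) = h y) \<and> f x = z"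
    proof cases
      case 1
      then show ?thesis by (rule *[OF A B AB _ z])
    next
      case 2
      have "connected (B \<inter> A)" "B \<inter> A \<noteq> {}" using AB by (simp_all add: Int_commute)
      from *[OF B A this 2 z] show ?thesis by (simp only: Un_commute)
    qed
  qed
qed

text \<open>Grid cells below a Lebesgue number lift by local sections. They are joined into rows and
  the rows into the square, each time along a segment, which is connected.\<close>

lemma liftable_unit_square:
  fixes h :: "real \<times> real \<Rightarrow> 'm"
  assumes h: "continuous_on ({0..1} \<times> {0..1}) h"
  shows "liftable h ({0..1} \<times> {0..1})"
proof -
  let ?I = "{0..1} \<times> {0..1} :: (real \<times> real) set"
  have "\<exists>V. open V \<and> y \<in> V \<and>
      (\<forall>z. p z \<in> V \<longrightarrow> (\<exists>s. continuous_on V s \<and> (\<forall>v\<in>V. p (s v) = v) \<and> s (p z) = z))" for y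
    by (rule local_section[of y]) blast
  then obtain V where V: "\<And>y. open (V y)" "\<And>y. y \<in> V y"
    "\<And>y z. p z \<in> V y \<Longrightarrow> \<exists>s. continuous_on (V y) s \<and> (\<forall>v\<in>V y. p (s v) = v) \<and> s (p z) = z"
    by metis
  have "\<exists>W. open W \<and> W \<inter> ?I = h -` V y \<inter> ?I" for y
    using h V(1)[of y] by (simp add: continuous_on_open_invariant)
  then obtain W where W: "\<And>y. open (W y)" "\<And>y. W y \<inter> ?I = h -` V y \<inter> ?I" by metis
  have cov: "?I \<subseteq> \<Union>(range W)"
  proof
    fix x assume "x \<in> ?I"
    with V(2)[of "h x"] W(2)[of "h x"] show "x \<in> \<Union>(range W)" by blast
  qed
  have cpt: "compact ?I" by (intro compact_Times compact_Icc)
  have ne: "range W \<noteq> {}" by simp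
  have opn: "open B" if "B \<in> range W" for B using W(1) that by blast
  obtain d where d: "0 < d" "\<And>T. T \<subseteq> ?I \<Longrightarrow> diameter T < d \<Longrightarrow> \<exists>B\<in>range W. T \<subseteq> B"
    using Lebesgue_number_lemma[OF cpt ne cov opn] by metis
  have small: "liftable h T" if T: "T \<subseteq> ?I" "diameter T < d" for T
    unfolding liftable_def
  proof (intro ballI allI impI)
    fix x z assume x: "x \<in> T" "p z = h x"
    obtain y where "T \<subseteq> W y" using d(2)[OF T] by blast
    then have TV: "h ` T \<subseteq> V y" using T(1) W(2)[of y] by blast
    then obtain s where s: "continuous_on (V y) s" "\<forall>v\<in>V y. p (s v) = v" "s (p z) = z"
      using V(3)[of z y] x by auto
    have "continuous_on T (s \<circ> h)"
      by (intro continuous_on_compose continuous_on_subset[OF h T(1)] continuous_on_subset[OF s(1) TV])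
    then show "\<exists>f. continuous_on T f \<and> (\<forall>y\<in>T. p (f y) = h y) \<and> f x = z"
      using s TV x by (intro exI[of _ "s \<circ> h"]) auto
  qed
  \<comment> \<open>Half of \<open>d\<close>, because the diameter of a cell is estimated by the sum
    of its two sides.\<close>
  obtain N :: nat where N: "1 / real (Suc N) < d / 2"
    using nat_approx_posE[of "d / 2"] d(1) by auto
  define n where "n = Suc N"
  define c where "c k = real k / real n" for k
  have c: "0 \<le> c k" "c k \<le> c (Suc k)" "c (Suc k) - c k < d / 2" "c 0 = 0" "c n = 1" for k
    using N by (auto simp: c_def n_def divide_simps)
  have c1: "c (Suc k) \<le> 1" if "k < n" for k
    using that by (auto simp: c_def divide_simps)
  have box: "liftable h ({c i..c (Suc i)} \<times> {c j..c (Suc j)})" if "i < n" "j < n" for i j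
  proof (rule small)
    show "{c i..c (Suc i)} \<times> {c j..c (Suc j)} \<subseteq> ?I"
      using c(1)[of i] c(1)[of j] c1[OF that(1)] c1[OF that(2)] by auto
    have "diameter ({c i..c (Suc i)} \<times> {c j..c (Suc j)}) \<le> (c (Suc i) - c i) + (c (Suc j) - c j)"
    proof (rule diameter_le)
      fix u v assume uv: "u \<in> {c i..c (Suc i)} \<times> {c j..c (Suc j)}" "v \<in> {c i..c (Suc i)} \<times> {c j..c (Suc j)}"
      have "norm (u - v) \<le> norm (fst (u - v)) + norm (snd (u - v))"
        using norm_Pair_le[of "fst (u - v)" "snd (u - v)"] unfolding prod.collapse .
      also have "\<dots> \<le> (c (Suc i) - c i) + (c (Suc j) - c j)"
        using uv by (intro add_mono) (auto simp: fst_diff snd_diff)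
      finally show "norm (u - v) \<le> (c (Suc i) - c i) + (c (Suc j) - c j)" .
    qed (use c(2) in auto)
    then show "diameter ({c i..c (Suc i)} \<times> {c j..c (Suc j)}) < d"
      using c(3)[of i] c(3)[of j] by linarith
  qed
  have row: "liftable h ({0..c (Suc i)} \<times> {c j..c (Suc j)})" if "i < n" "j < n" for i j
    using that(1)
  proof (induction i)
    case 0
    then show ?case using box[of 0 j] that(2) c(4) by simp
  next
    case (Suc i)
    have eq: "{0..c (Suc (Suc i))} = {0..c (Suc i)} \<union> {c (Suc i)..c (Suc (Suc i))}"
      using c(1)[of "Suc i"] c(2)[of "Suc i"] by auto
    have int: "({0..c (Suc i)} \<times> {c j..c (Suc j)}) \<inter> ({c (Suc i)..c (Suc (Suc i))} \<times> {c j..c (Suc j)}) =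
        {c (Suc i)} \<times> {c j..c (Suc j)}"
      using c(1)[of "Suc i"] c(2)[of "Suc i"] by auto
    show ?case
      unfolding eq Sigma_Un_distrib1
    proof (rule liftable_Un)
      show "liftable h ({0..c (Suc i)} \<times> {c j..c (Suc j)})" using Suc by simp
      show "liftable h ({c (Suc i)..c (Suc (Suc i))} \<times> {c j..c (Suc j)})"
        using box[of "Suc i" j] Suc.prems that(2) by simp
      show "connected (({0..c (Suc i)} \<times> {c j..c (Suc j)}) \<inter> ({c (Suc i)..c (Suc (Suc i))} \<times> {c j..c (Suc j)}))"
        unfolding int by (intro connected_Times) auto
      show "({0..c (Suc i)} \<times> {c j..c (Suc j)}) \<inter> ({c (Suc i)..c (Suc (Suc i))} \<times> {c j..c (Suc j)}) \<noteq> {}"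
        unfolding int using c(2)[of j] by auto
    qed (auto intro: closed_Times)
  qed
  have "liftable h ({0..1} \<times> {0..c (Suc j)})" if "j < n" for j
    using that
  proof (induction j)
    case 0
    then show ?case using row[of N 0] c(4,5) by (simp add: n_def)
  next
    case (Suc j)
    have eq: "{0..c (Suc (Suc j))} = {0..c (Suc j)} \<union> {c (Suc j)..c (Suc (Suc j))}"
      using c(1)[of "Suc j"] c(2)[of "Suc j"] by auto
    have int: "({0..1::real} \<times> {0..c (Suc j)}) \<inter> ({0..1} \<times> {c (Suc j)..c (Suc (Suc j))}) = {0..1} \<times> {c (Suc j)}"
      using c(1)[of "Suc j"] c(2)[of "Suc j"] by auto
    show ?case
      unfolding eq Sigma_Un_distrib2
    proof (rule liftable_Un)
      show "liftable h ({0..1} \<times> {0..c (Suc j)})" using Suc by simp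
      show "liftable h ({0..1} \<times> {c (Suc j)..c (Suc (Suc j))})"
        using row[of N "Suc j"] Suc.prems c(5) by (simp add: n_def)
      show "connected (({0..1::real} \<times> {0..c (Suc j)}) \<inter> ({0..1} \<times> {c (Suc j)..c (Suc (Suc j))}))"
        unfolding int by (intro connected_Times) auto
      show "({0..1::real} \<times> {0..c (Suc j)}) \<inter> ({0..1} \<times> {c (Suc j)..c (Suc (Suc j))}) \<noteq> {}"
        unfolding int by auto
    qed (auto intro: closed_Times)
  qed
  from this[of N] c(5) show ?thesis by (simp add: n_def)
qed

text \<open>In the lifted homotopy the side at parameter 1 and the \<open>deck \<sigma> k m\<close>
  image of the side at 0 lift the same path and meet over \<open>l\<close>, hence coincide. Starting
  at \<open>lt 0\<close> yields exactly \<open>k\<close> and \<open>m\<close>.\<close>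

lemma lift_freely_homotopic_loop:
  assumes hom: "homotopic_loops UNIV \<gamma> l"
    and lt: "path lt" "\<And>t. t \<in> {0..1} \<Longrightarrow> p (lt t) = l t" "lt 1 = deck \<sigma> k m (lt 0)"
  obtains a where "path a" "\<And>t. t \<in> {0..1} \<Longrightarrow> p (a t) = \<gamma> t" "a 1 = deck \<sigma> k m (a 0)"
proof -
  let ?I = "{0..1} :: real set"
  obtain h where h: "continuous_on (?I \<times> ?I) h" "\<And>x. x \<in> ?I \<Longrightarrow> h (0, x) = \<gamma> x"
      "\<And>x. x \<in> ?I \<Longrightarrow> h (1, x) = l x" "\<And>t. t \<in> ?I \<Longrightarrow> h (t, 1) = h (t, 0)"
    using hom unfolding homotopic_loops by (auto simp: pathstart_def pathfinish_def)
  have "p (lt 0) = h (1, 0)" using lt(2)[of 0] h(3)[of 0] by simp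
  moreover have "(1, 0) \<in> ?I \<times> ?I" by simp
  ultimately have "\<exists>f. continuous_on (?I \<times> ?I) f \<and> (\<forall>y\<in>?I \<times> ?I. p (f y) = h y) \<and> f (1, 0) = lt 0"
    using liftable_unit_square[OF h(1)] unfolding liftable_def by blast
  then obtain f where f: "continuous_on (?I \<times> ?I) f" "\<And>y. y \<in> ?I \<times> ?I \<Longrightarrow> p (f y) = h y" "f (1, 0) = lt 0"
    by blast
  have pf: "p (f (s, t)) = h (s, t)" if "s \<in> ?I" "t \<in> ?I" for s t using f(2) that by simp
  have edge: "continuous_on ?I (\<lambda>t. f (s, t))" "continuous_on ?I (\<lambda>t. f (t, s))" if "s \<in> ?I" for s
    by (rule continuous_on_compose2[OF f(1)]; use that in \<open>auto intro!: continuous_intros\<close>)+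
  have conn: "connected ?I" by simp
  have clt: "continuous_on ?I lt" using lt(1) by (simp add: path_def)
  have "f (1, 1) = lt 1"
  proof (rule lift_unique[OF conn edge(1) clt, where x = 0])
    show "p (f (1, t)) = p (lt t)" if "t \<in> ?I" for t using that pf[of 1 t] h(3) lt(2) by simp
  qed (use f(3) in auto)
  then have end_eq: "f (1, 1) = deck \<sigma> k m (f (1, 0))" using lt(3) f(3) by simp
  have cd: "continuous_on ?I (\<lambda>t. deck \<sigma> k m (f (t, 0)))"
    by (rule continuous_on_compose2[OF continuous_deck[of UNIV] edge(2)]) auto
  have "f (0, 1) = deck \<sigma> k m (f (0, 0))"
  proof (rule lift_unique[OF conn edge(2) cd, where x = 1])
    show "p (f (t, 1)) = p (deck \<sigma> k m (f (t, 0)))" if "t \<in> ?I" for t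
      using that pf[of t 1] pf[of t 0] h(4) by simp
  qed (use end_eq in auto)
  moreover have "path (\<lambda>t. f (0, t))" unfolding path_def by (intro edge) auto
  moreover have "p (f (0, t)) = \<gamma> t" if "t \<in> ?I" for t using that pf[of 0 t] h(2) by simp
  ultimately show thesis using that[of "\<lambda>t. f (0, t)"] by blast
qed

text \<open>
  A deck transformation of the \<open>j\<close>-th coordinate commutes with the projection, so it changes the
  potential \<open>f\<close> by a constant.
\<close>

lemma single_string_loops_cocycle_eq:
  fixes w :: "(real \<Rightarrow> 'm ^ 'n::finite) \<Rightarrow> real"
  assumes w: "path_cocycle config_space w"
    and A: "path A" "path_image A \<subseteq> config_space" "\<And>i t. i \<noteq> j \<Longrightarrow> t \<in> {0..1} \<Longrightarrow> A t $ i = A 0 $ i"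
      "homotopic_loops UNIV (\<lambda>t. A t $ j) l"
    and B: "path B" "path_image B \<subseteq> config_space" "\<And>i t. i \<noteq> j \<Longrightarrow> t \<in> {0..1} \<Longrightarrow> B t $ i = B 0 $ i"
      "homotopic_loops UNIV (\<lambda>t. B t $ j) l"
    and lt: "path lt" "\<And>t. t \<in> {0..1} \<Longrightarrow> p (lt t) = l t" "lt 1 = deck \<sigma> k m (lt 0)"
  shows "w A = w B"
proof -
  let ?X = "- \<Union>coincidences :: ((real \<times> real) ^ 'n) set"
  obtain f where f: "potential ?X (\<lambda>g. w (project \<circ> g)) f" using lifted_config_potential(2)[OF w] by blast
  define D :: "(real \<times> real) ^ 'n \<Rightarrow> (real \<times> real) ^ 'n" where
    "D z = (\<chi> i. if i = j then deck \<sigma> k m (z $ i) else z $ i)" for z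
  have PD: "project (D z) = project z" for z by (simp add: project_def D_def vec_eq_iff)
  have contD: "continuous_on S D" for S
    unfolding D_def
  proof (rule continuous_on_vec_lambda)
    show "continuous_on S (\<lambda>z. if i = j then deck \<sigma> k m (z $ i) else z $ i)" for i
      by (cases "i = j")
        (auto intro!: continuous_intros continuous_on_compose2[OF continuous_deck[of UNIV]])
  qed
  have DX: "D z \<in> ?X \<longleftrightarrow> z \<in> ?X" for z
    using project_in_config_space_iff[of z] project_in_config_space_iff[of "D z"] by (simp add: PD)
  have const: "f (D z) - f z = f (D z') - f z'" if z: "z \<in> ?X" "z' \<in> ?X" for z z'
  proof -
    obtain g where g: "path g" "path_image g \<subseteq> ?X" "pathstart g = z" "pathfinish g = z'"
      using lifted_config_potential(1)[OF w] z unfolding path_connected_def by blast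
    have "path (D \<circ> g)" using g(1) by (intro path_continuous_image contD)
    moreover have "path_image (D \<circ> g) \<subseteq> ?X" using g(2) DX by (auto simp: path_image_compose)
    ultimately have "w (project \<circ> (D \<circ> g)) = f (D z') - f (D z)"
      using potentialD[OF f] g by (simp add: pathstart_compose pathfinish_compose)
    moreover have "project \<circ> (D \<circ> g) = project \<circ> g" by (simp add: fun_eq_iff PD)
    moreover have "w (project \<circ> g) = f z' - f z" using potentialD[OF f g(1,2)] g by simp
    ultimately show ?thesis by simp
  qed
  have w_eq: "\<exists>z\<in>?X. w C = f (D z) - f z"
    if C: "path C" "path_image C \<subseteq> config_space" "\<And>i t. i \<noteq> j \<Longrightarrow> t \<in> {0..1} \<Longrightarrow> C t $ i = C 0 $ i"
      "homotopic_loops UNIV (\<lambda>t. C t $ j) l" for C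
  proof -
    obtain a where a: "path a" "\<And>t. t \<in> {0..1} \<Longrightarrow> p (a t) = C t $ j" "a 1 = deck \<sigma> k m (a 0)"
      by (rule lift_freely_homotopic_loop[OF C(4) lt]) (assumption, rule that)
    \<comment> \<open>An arbitrary lift of the initial configuration, from which only the resting
      coordinates are kept; coordinate \<open>j\<close> is the lifted loop \<open>a\<close>.\<close>
    obtain z where z: "project z = C 0" using project_surj by blast
    define b where "b t = (\<chi> i. if i = j then a t else z $ i)" for t
    have "continuous_on {0..1} b"
      unfolding b_def
    proof (rule continuous_on_vec_lambda)
      show "continuous_on {0..1} (\<lambda>t. if i = j then a t else z $ i)" for i
        using a(1) by (cases "i = j") (auto simp: path_def)
    qed
    then have b: "path b" by (simp add: path_def)
    have Pb: "C t = project (b t)" if t: "t \<in> {0..1}" for t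
    proof -
      have "p (z $ i) = C t $ i" if "i \<noteq> j" for i
        using arg_cong[OF z, of "\<lambda>x. x $ i"] C(3)[OF that t] by (simp add: project_def)
      then show ?thesis using a(2)[OF t] by (simp add: project_def b_def vec_eq_iff)
    qed
    have bX: "b t \<in> ?X" if t: "t \<in> {0..1}" for t
    proof -
      have "C t \<in> config_space" using C(2) t unfolding path_image_def by blast
      then show ?thesis using project_in_config_space_iff[of "b t"] Pb[OF t] by simp
    qed
    have "homotopic_paths config_space C (project \<circ> b)"
      using C Pb by (intro homotopic_paths_eq) auto
    then have "w C = w (project \<circ> b)" by (rule path_cocycle_homotopic[OF w])
    also have "\<dots> = f (b 1) - f (b 0)"
    proof -
      have "path_image b \<subseteq> ?X" using bX unfolding path_image_def by blast
      from potentialD[OF f b this] show ?thesis by (simp add: pathstart_def pathfinish_def)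
    qed
    also have "b 1 = D (b 0)" using a(3) by (simp add: b_def D_def vec_eq_iff)
    finally show ?thesis using bX[of 0] by (intro bexI[of _ "b 0"]) auto
  qed
  from w_eq[OF A] w_eq[OF B] const show ?thesis by metis
qed

end

section \<open>Permuting the strings\<close>

lemma klein_flat_surface: "flat_surface abs_klein (- 1)"
proof
  have deck: "deck (- 1) k m z = ((if even m then fst z else - fst z) + of_int k, snd z + of_int m)" for k m z
    by (simp add: deck_def twist_def)
  show "abs_klein z = abs_klein w \<longleftrightarrow> (\<exists>k m. w = deck (- 1) k m z)" for z w
    unfolding klein.abs_eq_iff klein_rel_def deck ..
  show "surj abs_klein"
    by (metis surjI Quotient3_abs_rep[OF Quotient3_klein])
  show "open U \<longleftrightarrow> open (abs_klein -` U)" for U by (rule open_klein_def)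
qed simp

lemma torus_flat_surface: "flat_surface abs_torus 1"
proof
  have deck: "deck 1 k m z = (fst z + of_int k, snd z + of_int m)" for k m z
    by (simp add: deck_def twist_def)
  show "abs_torus z = abs_torus w \<longleftrightarrow> (\<exists>k m. w = deck 1 k m z)" for z w
    unfolding torus.abs_eq_iff torus_rel_def deck ..
  show "surj abs_torus"
    by (metis surjI Quotient3_abs_rep[OF Quotient3_torus])
  show "open U \<longleftrightarrow> open (abs_torus -` U)" for U by (rule open_torus_def)
qed simp

lemma homeomorphism_permute_config:
  fixes \<tau> \<rho> :: "'n::finite \<Rightarrow> 'n"
  assumes "\<And>i. \<rho> (\<tau> i) = i" "\<And>i. \<tau> (\<rho> i) = i"
  shows "homeomorphism config_space config_space (\<lambda>x. \<chi> i. x $ \<tau> i) (\<lambda>x. \<chi> i. x $ \<rho> i)"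
proof -
  have inj: "\<tau> i \<noteq> \<tau> j" "\<rho> i \<noteq> \<rho> j" if "i \<noteq> j" for i j
    using assms that by metis+
  show ?thesis
    by (rule homeomorphismI) (auto intro!: continuous_intros simp: assms inj config_space_def)
qed

context flat_surface
begin

definition closing_lift :: "(real \<Rightarrow> 'm) \<Rightarrow> bool" where
  "closing_lift l \<longleftrightarrow>
     (\<exists>lt k m. path lt \<and> (\<forall>t\<in>{0..1}. p (lt t) = l t) \<and> lt 1 = deck \<sigma> k m (lt 0))"

lemma closing_liftI:
  "path lt \<Longrightarrow> (\<And>t. p (lt t) = l t) \<Longrightarrow> lt 1 = deck \<sigma> k m (lt 0) \<Longrightarrow> closing_lift l"
  unfolding closing_lift_def by blast

text \<open>\<open>\<phi>\<close> is chosen before \<open>l\<close>, \<open>b\<close> and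
  \<open>u\<close>: on the torus a single automorphism has to permute both families of
  generators.\<close>

lemma ex_permuting_automorphism:
  fixes q :: "'m ^ 'n::finite" and \<tau> :: "'n \<Rightarrow> 'n"
  assumes \<tau>: "bij \<tau>" and q: "q \<in> config_space"
  shows "\<exists>\<phi>\<in>iso (pure_braid_group q) (pure_braid_group q).
    \<forall>l b u. closing_lift l \<and> (\<forall>i. b i \<in> single_string_braids q l i) \<and>
      u \<in> hom (pure_braid_group q) additive_reals \<longrightarrow> (\<forall>i. u (\<phi> (b i)) = u (b (\<tau> i)))"
proof -
  let ?F = "config_space :: ('m ^ 'n) set"
  define \<rho> where "\<rho> = inv_into UNIV \<tau>"
  have \<rho>: "\<rho> (\<tau> i) = i" "\<tau> (\<rho> i) = i" for i
    using \<tau> by (simp_all add: \<rho>_def bij_is_inj bij_is_surj surj_f_inv_f)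
  \<comment> \<open>With the inverse \<open>\<rho>\<close>, coordinate \<open>\<tau> i\<close> of
    \<open>T x\<close> is \<open>x $ i\<close>, so a braid moving string \<open>i\<close> becomes
    one moving string \<open>\<tau> i\<close>.\<close>
  define T where "T = (\<lambda>x :: 'm ^ 'n. \<chi> i. x $ \<rho> i)"
  have T: "homeomorphism ?F ?F T (\<lambda>x. \<chi> i. x $ \<tau> i)"
    unfolding T_def by (rule homeomorphism_permute_config[OF \<rho>(2,1)])
  then have TF: "T \<in> ?F \<rightarrow> ?F" "continuous_on ?F T" by (auto simp: homeomorphism_def)
  obtain c where c: "path_in ?F c q (T q)"
    using path_connected_config_space q TF(1) unfolding path_connected_def path_in_def by blast
  obtain \<phi> where \<phi>: "\<phi> \<in> iso (pure_braid_group q) (pure_braid_group q)"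
    "\<And>g. g \<in> based_loops ?F q \<Longrightarrow>
      \<phi> (path_class ?F g) = path_class ?F (c +++ ((T \<circ> g) +++ reversepath c))"
    using homeomorphism_change_base_iso[OF T q c] unfolding pure_braid_group_def by blast
  have "u (\<phi> (b i)) = u (b (\<tau> i))"
    if l: "closing_lift l" and b: "\<And>i. b i \<in> single_string_braids q l i"
      and u: "u \<in> hom (pure_braid_group q) additive_reals" for l b u i
  proof -
    obtain w where w: "path_cocycle ?F w" "\<And>g. g \<in> based_loops ?F q \<Longrightarrow> w g = u (path_class ?F g)"
      using hom_extends_to_path_cocycle[OF path_connected_config_space q u[unfolded pure_braid_group_def]]
      by blast
    have "\<exists>g. b i = path_class ?F g \<and> g \<in> based_loops ?F q \<and>
        (\<forall>j. j \<noteq> i \<longrightarrow> (\<forall>t\<in>{0..1}. g t $ j = q $ j)) \<and> homotopic_loops UNIV (\<lambda>t. g t $ i) l" for i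
      using b[of i] unfolding single_string_braids_def by blast
    then obtain g where g: "\<And>i. b i = path_class ?F (g i)" "\<And>i. g i \<in> based_loops ?F q"
      "\<And>i j t. j \<noteq> i \<Longrightarrow> t \<in> {0..1} \<Longrightarrow> g i t $ j = q $ j"
      "\<And>i. homotopic_loops UNIV (\<lambda>t. g i t $ i) l"
      by metis
    have loop: "path (g j)" "path_image (g j) \<subseteq> ?F" "pathstart (g j) = q" "pathfinish (g j) = q" for j
      using g(2)[of j] by (auto simp: based_loops_def)
    have Tg: "path_in ?F (T \<circ> g i) (T q) (T q)"
    proof -
      have "path (T \<circ> g i)"
        using loop by (intro path_continuous_image continuous_on_subset[OF TF(2)])
      moreover have "path_image (T \<circ> g i) \<subseteq> ?F"
        using loop(2) TF(1) by (auto simp: path_image_compose)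
      ultimately show ?thesis
        by (simp add: path_in_def pathstart_compose pathfinish_compose loop)
    qed
    \<comment> \<open>The two braids are based at \<open>T q\<close> and \<open>q\<close>, so they
      can be compared only through the cocycle, not in the group.\<close>
    have "w (T \<circ> g i) = w (g (\<tau> i))"
    proof -
      obtain lt k m where lt: "path lt" "\<And>t. t \<in> {0..1} \<Longrightarrow> p (lt t) = l t" "lt 1 = deck \<sigma> k m (lt 0)"
        using l unfolding closing_lift_def by blast
      show ?thesis
      proof (rule single_string_loops_cocycle_eq[OF w(1) _ _ _ _ _ _ _ _ lt, where j = "\<tau> i"])
        show "(T \<circ> g i) t $ j = (T \<circ> g i) 0 $ j" if "j \<noteq> \<tau> i" "t \<in> {0..1}" for j t
        proof -
          have "\<rho> j \<noteq> i" using that(1) \<rho>(2) by metis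
          then show ?thesis using g(3) that(2) by (simp add: T_def)
        qed
        show "g (\<tau> i) t $ j = g (\<tau> i) 0 $ j" if "j \<noteq> \<tau> i" "t \<in> {0..1}" for j t
          using g(3)[OF that(1)] that(2) by simp
        show "homotopic_loops UNIV (\<lambda>t. (T \<circ> g i) t $ \<tau> i) l"
          using g(4)[of i] by (simp add: T_def \<rho>)
      qed (use Tg loop g(4) in \<open>auto simp: path_in_def\<close>)
    qed
    moreover have "w (c +++ ((T \<circ> g i) +++ reversepath c)) = w (T \<circ> g i)"
    proof -
      have "w (c +++ ((T \<circ> g i) +++ reversepath c)) = w c + w ((T \<circ> g i) +++ reversepath c)"
        using c path_in_join[OF Tg path_in_reversepath[OF c]]
        by (intro path_cocycle_join[OF w(1)]) (auto simp: path_in_def)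
      also have "w ((T \<circ> g i) +++ reversepath c) = w (T \<circ> g i) + w (reversepath c)"
        using Tg path_in_reversepath[OF c] by (intro path_cocycle_join[OF w(1)]) (auto simp: path_in_def)
      also have "w (reversepath c) = - w c"
        using c by (intro path_cocycle_reversepath[OF w(1)]) (auto simp: path_in_def)
      finally show ?thesis by linarith
    qed
    moreover have "c +++ ((T \<circ> g i) +++ reversepath c) \<in> based_loops ?F q"
      using path_in_join[OF c path_in_join[OF Tg path_in_reversepath[OF c]]] by (simp add: path_in_loop_iff)
    ultimately show ?thesis
      using w(2) g(1,2) \<phi>(2)[OF g(2)] by metis
  qed
  with \<phi>(1) show ?thesis by blast
qed

end

section \<open>Coordinates on the character sphere\<close>

lemma single_string_braids_subset_carrier:
  "single_string_braids q l i \<subseteq> carrier (pure_braid_group q)"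
  unfolding single_string_braids_def pure_braid_group_def carrier_fundamental_group by blast

lemma character_sphere_repr:
  assumes "C \<in> character_sphere G"
  obtains u where "u \<in> nonzero_characters G" "C = character_rel G `` {u}" "u \<in> C"
proof -
  obtain u where u: "u \<in> nonzero_characters G" "C = character_rel G `` {u}"
    using assms unfolding character_sphere_def by (rule quotientE)
  moreover have "(u, u) \<in> character_rel G"
    using u(1) unfolding character_rel_def by (auto intro!: exI[of _ 1])
  ultimately show thesis using that by blast
qed

lemma character_relD:
  assumes "v \<in> character_rel G `` {u}"
  shows "v \<in> nonzero_characters G" "\<exists>r>0. \<forall>x\<in>carrier G. v x = r * u x"
  using assms by (auto simp: character_rel_def)

lemma the_elem_image_constant:
  assumes "\<And>v. v \<in> C \<Longrightarrow> f v = x" "u \<in> C"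
  shows "the_elem (f ` C) = x"
proof -
  have "f ` C = {x}" using assms by auto
  then show ?thesis by simp
qed

lemma compose_nonzero_character:
  assumes "group G" and \<phi>: "\<phi> \<in> iso G G" and u: "u \<in> nonzero_characters G"
  shows "compose (carrier G) u \<phi> \<in> nonzero_characters G"
proof -
  interpret group G by fact
  have hom: "\<phi> \<in> hom G G" and im: "\<phi> ` carrier G = carrier G"
    using \<phi> by (auto simp: iso_def bij_betw_def)
  have "compose (carrier G) u \<phi> \<in> hom G additive_reals"
    using hom_compose[OF hom, of u additive_reals] u
    by (simp add: nonzero_characters_def hom_def compose_def Pi_iff)
  moreover obtain x where "x \<in> carrier G" "u x \<noteq> 0" using u by (auto simp: nonzero_characters_def)
  moreover from this obtain y where "y \<in> carrier G" "\<phi> y = x" using im by (metis imageE)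
  ultimately show ?thesis
    by (auto simp: nonzero_characters_def compose_def intro!: bexI[of _ y])
qed

lemma induced_sphere_map_repr:
  assumes v: "v \<in> induced_sphere_map G \<phi> C"
  shows "\<exists>u\<in>C. \<exists>r>0. \<forall>x\<in>carrier G. v x = r * u (\<phi> x)"
proof -
  obtain u where u: "u \<in> C" "v \<in> character_rel G `` {compose (carrier G) u \<phi>}"
    using v unfolding induced_sphere_map_def by blast
  from character_relD(2)[OF u(2)] have "\<exists>r>0. \<forall>x\<in>carrier G. v x = r * u (\<phi> x)"
    by (simp add: compose_def)
  with u(1) show ?thesis by blast
qed

text \<open>The coordinates are \<open>the_elem\<close> of an image; a constant value determines it
  only if the class is inhabited.\<close>

lemma induced_sphere_map_nonempty:
  assumes G: "group G" and \<phi>: "\<phi> \<in> iso G G" and C: "C \<in> character_sphere G"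
  shows "\<exists>v. v \<in> induced_sphere_map G \<phi> C"
proof -
  obtain u where u: "u \<in> nonzero_characters G" "u \<in> C" by (rule character_sphere_repr[OF C])
  let ?v = "compose (carrier G) u \<phi>"
  have "(?v, ?v) \<in> character_rel G"
    using compose_nonzero_character[OF G \<phi> u(1)] by (auto simp: character_rel_def intro!: exI[of _ 1])
  with u(2) show ?thesis unfolding induced_sphere_map_def by blast
qed

lemma sgn_scale_pos: "0 < r \<Longrightarrow> sgn (r *\<^sub>R x) = sgn x" for x :: "'a::real_normed_vector"
  by (simp add: sgn_scaleR)

lemma norm_permute_coords:
  assumes "bij \<tau>"
  shows "norm (permute_coords \<tau> x) = norm x"
proof -
  have "(\<Sum>i\<in>UNIV. (norm (x $ \<tau> i))\<^sup>2) = (\<Sum>i\<in>UNIV. (norm (x $ i))\<^sup>2)"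
    using sum.reindex_bij_betw[OF assms, of "\<lambda>i. (norm (x $ i))\<^sup>2"] .
  then show ?thesis by (simp add: norm_vec_def L2_set_def permute_coords_def)
qed

lemma permute_coords_scaleR: "permute_coords \<tau> (r *\<^sub>R x) = r *\<^sub>R permute_coords \<tau> x"
  by (simp add: permute_coords_def vec_eq_iff)

text \<open>Permuting coordinates is linear and preserves the norm, so it commutes with
  normalization.\<close>

lemma sgn_permute_coords: "bij \<tau> \<Longrightarrow> sgn (permute_coords \<tau> x) = permute_coords \<tau> (sgn x)"
  by (simp add: sgn_div_norm norm_permute_coords permute_coords_scaleR)

lemma sgn_permute_coords_prod:
  assumes "bij \<tau>"
  shows "sgn (map_prod (permute_coords \<tau>) (permute_coords \<tau>) z) =
    map_prod (permute_coords \<tau>) (permute_coords \<tau>) (sgn z)"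
  by (cases z) (simp add: sgn_div_norm norm_Pair norm_permute_coords[OF assms] permute_coords_scaleR)

text \<open>The coordinates of \<open>[u]\<close> are read off a linear function \<open>\<Theta>\<close> of the character \<open>u\<close>.\<close>

lemma sphere_coords_permuted:
  fixes \<Theta> :: "('g \<Rightarrow> real) \<Rightarrow> 'v::real_normed_vector"
  assumes G: "group G" and \<phi>: "\<phi> \<in> iso G G" and C: "C \<in> character_sphere G"
    and scale: "\<And>u v r. (\<And>x. x \<in> carrier G \<Longrightarrow> v x = r * u x) \<Longrightarrow> \<Theta> v = r *\<^sub>R \<Theta> u"
    and \<Theta>: "\<And>u. u \<in> hom G additive_reals \<Longrightarrow> \<Theta> (\<lambda>x. u (\<phi> x)) = \<pi> (\<Theta> u)"
    and \<pi>: "\<And>x. sgn (\<pi> x) = \<pi> (sgn x)"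
  shows "the_elem ((\<lambda>u. sgn (\<Theta> u)) ` induced_sphere_map G \<phi> C) = \<pi> (the_elem ((\<lambda>u. sgn (\<Theta> u)) ` C))"
proof -
  obtain u where u: "u \<in> nonzero_characters G" "C = character_rel G `` {u}" "u \<in> C"
    by (rule character_sphere_repr[OF C])
  have C_eq: "sgn (\<Theta> v) = sgn (\<Theta> u)" if "v \<in> C" for v
  proof -
    obtain r where r: "0 < r" "\<forall>x\<in>carrier G. v x = r * u x"
      using character_relD(2) \<open>v \<in> C\<close> unfolding u(2) by blast
    then have "\<Theta> v = r *\<^sub>R \<Theta> u" by (intro scale) simp
    with r(1) show ?thesis by (simp add: sgn_scale_pos)
  qed
  have hom: "v \<in> hom G additive_reals" if "v \<in> C" for v
    using character_relD(1)[of v G u] that unfolding u(2) by (simp add: nonzero_characters_def)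
  have "sgn (\<Theta> v) = \<pi> (sgn (\<Theta> u))" if v: "v \<in> induced_sphere_map G \<phi> C" for v
  proof -
    obtain u' r where u': "u' \<in> C" "0 < r" "\<forall>x\<in>carrier G. v x = r * u' (\<phi> x)"
      using induced_sphere_map_repr[OF v] by blast
    have "sgn (\<Theta> v) = sgn (\<Theta> (\<lambda>x. u' (\<phi> x)))"
      using scale[of v r "\<lambda>x. u' (\<phi> x)"] u'(2,3) by (simp add: sgn_scale_pos)
    also have "\<dots> = \<pi> (sgn (\<Theta> u))"
      by (simp add: \<Theta>[OF hom[OF u'(1)]] \<pi> C_eq[OF u'(1)])
    finally show ?thesis .
  qed
  moreover obtain v where "v \<in> induced_sphere_map G \<phi> C"
    using induced_sphere_map_nonempty[OF G \<phi> C] by blast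
  ultimately have "the_elem ((\<lambda>u. sgn (\<Theta> u)) ` induced_sphere_map G \<phi> C) = \<pi> (sgn (\<Theta> u))"
    by (rule the_elem_image_constant)
  moreover have "the_elem ((\<lambda>u. sgn (\<Theta> u)) ` C) = sgn (\<Theta> u)"
    using C_eq u(3) by (rule the_elem_image_constant)
  ultimately show ?thesis by simp
qed

theorem corollary4p2:
  fixes \<tau> :: "'n::finite \<Rightarrow> 'n"
  assumes "bij \<tau>"
  shows "(\<forall>(p :: klein ^ 'n) b.
            p \<in> config_space \<and>
            (\<forall>i. b i \<in> single_string_braids p klein_loop_b i) \<longrightarrow>
            (\<exists>\<phi> \<in> iso (pure_braid_group p) (pure_braid_group p).
               \<forall>C \<in> character_sphere (pure_braid_group p).
                 klein_sphere_coords b (induced_sphere_map (pure_braid_group p) \<phi> C) =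
                 permute_coords \<tau> (klein_sphere_coords b C))) \<and>
         (\<forall>(p :: torus ^ 'n) a b.
            p \<in> config_space \<and>
            (\<forall>i. a i \<in> single_string_braids p torus_loop_a i) \<and>
            (\<forall>i. b i \<in> single_string_braids p torus_loop_b i) \<longrightarrow>
            (\<exists>\<phi> \<in> iso (pure_braid_group p) (pure_braid_group p).
               \<forall>C \<in> character_sphere (pure_braid_group p).
                 torus_sphere_coords a b (induced_sphere_map (pure_braid_group p) \<phi> C) =
                 map_prod (permute_coords \<tau>) (permute_coords \<tau>) (torus_sphere_coords a b C)))"
proof (intro conjI allI impI; elim conjE)
  fix p :: "klein ^ 'n" and b
  assume p: "p \<in> config_space" and b: "\<forall>i. b i \<in> single_string_braids p klein_loop_b i"
  interpret flat_surface abs_klein "- 1" by (rule klein_flat_surface)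
  let ?G = "pure_braid_group p"
  have G: "group ?G" unfolding pure_braid_group_def by (rule group_fundamental_group[OF p])
  have lift: "closing_lift klein_loop_b"
    by (rule closing_liftI[where lt = "\<lambda>t. (0, t)" and k = 0 and m = 1])
      (auto simp: klein_loop_b_def path_def deck_def intro!: continuous_intros)
  obtain \<phi> where \<phi>: "\<phi> \<in> iso ?G ?G"
    "\<And>u i. u \<in> hom ?G additive_reals \<Longrightarrow> u (\<phi> (b i)) = u (b (\<tau> i))"
    using ex_permuting_automorphism[OF assms p] lift b by blast
  have car: "b i \<in> carrier ?G" for i using b single_string_braids_subset_carrier by blast
  show "\<exists>\<phi> \<in> iso ?G ?G. \<forall>C \<in> character_sphere ?G.
      klein_sphere_coords b (induced_sphere_map ?G \<phi> C) = permute_coords \<tau> (klein_sphere_coords b C)"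
  proof (intro bexI[OF _ \<phi>(1)] ballI)
    fix C assume C: "C \<in> character_sphere ?G"
    \<comment> \<open>Here \<open>\<Theta> u\<close> is the vector of the values
      \<open>u (b i)\<close>, and \<open>\<pi>\<close> is
      \<open>permute_coords \<tau>\<close>.\<close>
    show "klein_sphere_coords b (induced_sphere_map ?G \<phi> C) = permute_coords \<tau> (klein_sphere_coords b C)"
      unfolding klein_sphere_coords_def
      by (rule sphere_coords_permuted[OF G \<phi>(1) C])
        (simp_all add: vec_eq_iff car \<phi>(2) permute_coords_def[of \<tau> "\<chi> i. _ i"] sgn_permute_coords[OF assms])
  qed
next
  fix p :: "torus ^ 'n" and a b
  assume p: "p \<in> config_space" and a: "\<forall>i. a i \<in> single_string_braids p torus_loop_a i"
    and b: "\<forall>i. b i \<in> single_string_braids p torus_loop_b i"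
  interpret flat_surface abs_torus 1 by (rule torus_flat_surface)
  let ?G = "pure_braid_group p"
  have G: "group ?G" unfolding pure_braid_group_def by (rule group_fundamental_group[OF p])
  have lift_a: "closing_lift torus_loop_a"
    by (rule closing_liftI[where lt = "\<lambda>t. (t, 0)" and k = 1 and m = 0])
      (auto simp: torus_loop_a_def path_def deck_def intro!: continuous_intros)
  have lift_b: "closing_lift torus_loop_b"
    by (rule closing_liftI[where lt = "\<lambda>t. (0, t)" and k = 0 and m = 1])
      (auto simp: torus_loop_b_def path_def deck_def intro!: continuous_intros)
  obtain \<phi> where \<phi>: "\<phi> \<in> iso ?G ?G"
    "\<And>u i. u \<in> hom ?G additive_reals \<Longrightarrow> u (\<phi> (a i)) = u (a (\<tau> i))"
    "\<And>u i. u \<in> hom ?G additive_reals \<Longrightarrow> u (\<phi> (b i)) = u (b (\<tau> i))"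
    using ex_permuting_automorphism[OF assms p] lift_a lift_b a b by blast
  have car: "a i \<in> carrier ?G" "b i \<in> carrier ?G" for i
    using a b single_string_braids_subset_carrier by blast+
  show "\<exists>\<phi> \<in> iso ?G ?G. \<forall>C \<in> character_sphere ?G.
      torus_sphere_coords a b (induced_sphere_map ?G \<phi> C) =
      map_prod (permute_coords \<tau>) (permute_coords \<tau>) (torus_sphere_coords a b C)"
  proof (intro bexI[OF _ \<phi>(1)] ballI)
    fix C assume C: "C \<in> character_sphere ?G"
    \<comment> \<open>Both families form one vector \<open>\<Theta> u\<close>, normalized jointly,
      and \<open>\<pi>\<close> permutes its two halves simultaneously.\<close>
    show "torus_sphere_coords a b (induced_sphere_map ?G \<phi> C) =
        map_prod (permute_coords \<tau>) (permute_coords \<tau>) (torus_sphere_coords a b C)"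
      unfolding torus_sphere_coords_def
      by (rule sphere_coords_permuted[OF G \<phi>(1) C])
        (simp_all add: vec_eq_iff car \<phi>(2,3) permute_coords_def[of \<tau> "\<chi> i. _ i"] sgn_permute_coords_prod[OF assms])
  qed
qed

end
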